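(* Let $(\Omega,\mathcal{F},\mathbb{P})$ be a probability space with a filtration $(\mathcal{F}_n)_{n\ge 0}$. Let $b>0$, $x_0\in\mathbb{R}$, let $g:\mathbb{R}\to\mathbb{R}$ be a twice differentiable function, let $(U_n)_{n\ge 1}$ be a real-valued sequence adapted to $(\mathcal{F}_n)_{n\ge 1}$, and let $(X_n)_{n\ge 0}$ be the real-valued process adapted to $(\mathcal{F}_n)_{n\ge 0}$ with $$X_{n+1}-X_n=\frac{b}{n+1}\big[g(X_n)+U_{n+1}\big]\quad (n\ge 0),\qquad X_0=x_0 .$$ Assume that there are positive constants $K_u,\sigma,K_a,K_1,K_2$ such that: (a) for all $n\ge 0$, $\mathbb{E}[U_{n+1}\mid\mathcal{F}_n]=0$ and $|U_{n+1}|\le K_u$; (b) for all $n\ge 0$, $\mathbb{E}[U_{n+1}^2\mid\mathcal{F}_n]=\sigma^2$ a.s.; (c) for all $x\in\mathbb{R}$, $|g''(x)|\le K_a$; (d) $g$ has a unique stable point $x^*$ and, for all $x\in\mathbb{R}$, $K_1|x-x^*|\le|g(x)|\le K_2|x-x^*|$. Assume moreover that $b g'(x^* )<-1$. Let $(b_n)_{n\ge 1}$ be a sequence of positive numbers such that $b_n\to\infty$ and $b_n=O\big(n^{\frac{1}{2(1+\gamma)}}\big)$ for a constant $\gamma>0$. Then, for any $r>0$, $$\lim_{n\to\infty}\frac{1}{b_n^2}\log\mathbb{P}\left(h_n|X_{n+1}-x^*|>r b_n\right)=-\frac{r^2}{2\sigma^2},$$ where $$h_n:=\left(b^2\sum_{k=0}^n(k+1)^{-2}\left(\beta_{k+1}^n\left(bg'(x^*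 )\right)\right)^2\right)^{-1/2},\qquad \beta_k^n\left(bg'(x^* )\right):=\prod_{j=k}^n\left(1+\frac{bg'(x^* )}{j+1}\right).$$
   Context: A stable point of $g$ is a point $x^*\in\mathbb{R}$ with $g(x^* )=0$ and $g'(x^* )<0$. The empty product equals $1$, i.e. $\beta_{n+1}^n(\cdot)=1$. *)

theory Defs
  imports "HOL-Probability.Probability" "HOL-Library.Landau_Symbols"
begin

definition stable_point :: "(real \<Rightarrow> real) \<Rightarrow> real \<Rightarrow> bool" where
  "stable_point g x \<longleftrightarrow> g x = 0 \<and> deriv g x < 0"

text \<open>
  \<open>beta_prod k n c\<close> is $\beta_k^n(c)$. For \<open>k = n + 1\<close> the index set is empty and the value is 1.
\<close>

definition beta_prod :: "nat \<Rightarrow> nat \<Rightarrow> real \<Rightarrow> real" where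
  "beta_prod k n c = (\<Prod>j\<in>{k..n}. 1 + c / real (j + 1))"

text \<open>
  In the next definition \<open>c\<close> stands for $b g'(x^*)$. The summand \<open>k = n\<close> equals
  $1/(n+1)^2$, so for \<open>b > 0\<close> the base of \<open>powr\<close> is positive.
\<close>

definition h_norm :: "real \<Rightarrow> real \<Rightarrow> nat \<Rightarrow> real" where
  "h_norm b c n =
     (b\<^sup>2 * (\<Sum>k\<in>{0..n}. 1 / (real (k + 1))\<^sup>2 * (beta_prod (k + 1) n c)\<^sup>2)) powr (- 1 / 2)"

end

theory Submission
  imports Defs
begin

text \<open>
  Write \<open>Y n = X n - xstar\<close> and \<open>c = b * deriv g xstar < -1\<close>. Replacing \<open>g\<close> by its linear part at
  \<open>xstar\<close> turns the recursion into a linear one with solution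
  \<open>Y (n + 1) = beta_prod 0 n c * Y 0 + (\<Sum>k\<le>n. w n k * (R k + U (k + 1)))\<close>, where
  \<open>w n k = b / (k + 1) * beta_prod (k + 1) n c\<close> and \<open>\<bar>R k\<bar> \<le> Ka * (Y k)\<^sup>2\<close> is the linearisation error. The
  factor \<open>h n = h_norm b c n\<close> normalises the weights to Euclidean norm 1, and the statement says that
  \<open>h n * Y (n + 1)\<close> has the moderate deviations of a Gaussian variable of variance \<open>\<sigma>\<^sup>2\<close>.

  The noise part \<open>S n = (\<Sum>k\<le>n. h n * w n k * U (k + 1))\<close> does. As \<open>c < -1\<close>, all normalised weights
  are \<open>O(1 / sqrt n)\<close> (\<open>normalised_noise_weights\<close>). As \<open>bs n = o(sqrt n)\<close>, the exponents
  \<open>t * bs n * h n * w n k * U (k + 1)\<close> are uniformly small, and expanding the exponential to second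
  order under the conditional expectation, where the conditional variance is the constant \<open>\<sigma>\<^sup>2\<close>, gives
  \<open>ln (E (exp (t * bs n * S n))) / (bs n)\<^sup>2 \<longlonglongrightarrow> t\<^sup>2 * \<sigma>\<^sup>2 / 2\<close>
  (\<open>gaussian_log_moments_weighted_noise\<close>). The tails of \<open>S n\<close> follow by Chernoff's bound and a
  localisation argument for the lower bound (\<open>tail_upper_bound\<close>, \<open>tail_lower_bound\<close>).

  The rest is negligible. It is bounded by a multiple of
  \<open>(1 + (\<Sum>k\<le>n. (Y k)\<^sup>2)) / sqrt n\<close>, so it suffices that the sum of the squared errors has an exponential
  moment of size \<open>exp (O(sqrt n))\<close>: then the remainder exceeds \<open>\<eta> * bs n\<close> with probability at most
  \<open>exp (O(sqrt n) - const * bs n * sqrt n)\<close>, which is smaller than \<open>exp (- L * (bs n)\<^sup>2)\<close> for every \<open>L\<close>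
  (\<open>scaled_functional_negligible\<close>). The difficulty is that the
  contraction rate \<open>b * K1\<close> of \<open>g\<close> far from \<open>xstar\<close> may be much smaller than the rate \<open>- c\<close> close to it.
  The function \<open>\<phi> y = y\<^sup>2 + N * y ^ (2 * q + 2)\<close> with large \<open>q\<close> and \<open>N\<close> nevertheless decays along the
  drift at relative rate 2 everywhere (\<open>lyapunov_polynomial\<close>). This is more than the rate 1 that compensates the
  growth of the factor \<open>n\<close> in \<open>n * \<phi> (Y n)\<close>, and the surplus bounds the exponential
  moments of the sum of the \<open>\<phi> (Y k)\<close> (\<open>exponential_moment_sum_squares\<close>). All trajectories stay in a fixed
  bounded interval (\<open>mean_reverting_trajectories_bounded\<close>), so second order terms are harmless.
\<close>

section \<open>The weights of the linearised recursion\<close>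

text \<open>The factor with which a perturbation of the linear recursion at step \<open>k\<close> enters its value at time \<open>n + 1\<close>.\<close>

definition noise_weight :: "real \<Rightarrow> real \<Rightarrow> nat \<Rightarrow> nat \<Rightarrow> real" where
  "noise_weight b c n k = b / real (k + 1) * beta_prod (k + 1) n c"

lemma noise_weight_diag: "noise_weight b c n n = b / real (n + 1)"
  by (simp add: noise_weight_def beta_prod_def)

lemma beta_prod_Suc:
  "k \<le> Suc n \<Longrightarrow> beta_prod k (Suc n) c = (1 + c / real (n + 2)) * beta_prod k n c"
  by (simp add: beta_prod_def mult.commute)

lemma noise_weight_Suc:
  "k \<le> n \<Longrightarrow> noise_weight b c (Suc n) k = (1 + c / real (n + 2)) * noise_weight b c n k"
  by (simp add: noise_weight_def beta_prod_Suc)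

lemma linear_recursion_solution:
  fixes y e :: "nat \<Rightarrow> real"
  assumes "\<And>n. y (Suc n) = (1 + c / real (n + 1)) * y n + b / real (n + 1) * e n"
  shows "y (Suc n) = beta_prod 0 n c * y 0 + (\<Sum>k\<le>n. noise_weight b c n k * e k)"
proof (induction n)
  case 0
  show ?case using assms[of 0] by (simp add: beta_prod_def noise_weight_def)
next
  case (Suc n)
  have "y (Suc (Suc n)) = (1 + c / real (n + 2)) * y (Suc n) + b / real (n + 2) * e (Suc n)"
    using assms[of "Suc n"] by simp
  also have "\<dots> = beta_prod 0 (Suc n) c * y 0
      + (\<Sum>k\<le>n. (1 + c / real (n + 2)) * noise_weight b c n k * e k) + b / real (n + 2) * e (Suc n)"
    by (simp add: Suc.IH beta_prod_Suc distrib_left sum_distrib_left mult.assoc)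
  also have "(\<Sum>k\<le>n. (1 + c / real (n + 2)) * noise_weight b c n k * e k)
      = (\<Sum>k\<le>n. noise_weight b c (Suc n) k * e k)"
    by (intro sum.cong) (auto simp: noise_weight_Suc)
  finally show ?case by (simp add: noise_weight_diag)
qed

lemma h_norm_eq: "h_norm b c n = 1 / sqrt (\<Sum>k\<le>n. (noise_weight b c n k)\<^sup>2)"
proof -
  have "b\<^sup>2 * (\<Sum>k\<in>{0..n}. 1 / (real (k + 1))\<^sup>2 * (beta_prod (k + 1) n c)\<^sup>2)
      = (\<Sum>k\<le>n. (noise_weight b c n k)\<^sup>2)"
    by (simp add: noise_weight_def sum_distrib_left power_mult_distrib power_divide atMost_atLeast0)
  moreover have "0 \<le> (\<Sum>k\<le>n. (noise_weight b c n k)\<^sup>2)" by (simp add: sum_nonneg)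
  moreover have "s powr (- 1 / 2) = 1 / sqrt s" if "0 \<le> s" for s :: real
    using that powr_minus_divide[of s "1 / 2"] by (simp add: powr_half_sqrt)
  ultimately show ?thesis
    unfolding h_norm_def by presburger
qed

text \<open>
  Passing from \<open>n\<close> to \<open>n + 1\<close> multiplies \<open>(n + 1) * \<bar>noise_weight b c n k\<bar>\<close> by
  \<open>\<bar>n + 2 + c\<bar> / (n + 1)\<close>. Since \<open>c \<le> -1\<close>, this factor is at most 1 as soon as \<open>n + 2 \<ge> -c\<close>; before
  that it is at most \<open>-c\<close>. For \<open>-1 < c < 0\<close> the oldest weights would be the largest and would
  decay only like \<open>n powr c\<close>.
\<close>

lemma noise_weight_bound:
  assumes "b > 0" "c \<le> -1"
  obtains C where "C > 0" "\<And>n k. k \<le> n \<Longrightarrow> \<bar>noise_weight b c n k\<bar> \<le> C / real (n + 1)"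
proof -
  obtain N where N: "-c \<le> real N" using real_arch_simple by blast
  \<comment> \<open>Only the first \<open>N\<close> steps can increase the weight relative to \<open>1 / (n + 1)\<close>.\<close>
  have step: "real (n + 1) * \<bar>noise_weight b c n k\<bar> \<le> b * (-c) ^ min n N" if "k \<le> n" for n k
    using that
  proof (induction n)
    case 0
    then show ?case using assms by (simp add: noise_weight_diag)
  next
    case (Suc n)
    show ?case
    proof (cases "k = Suc n")
      case True
      have "1 \<le> (-c) ^ min (Suc n) N" by (rule one_le_power) (use assms in simp)
      then show ?thesis using True assms by (simp add: noise_weight_diag)
    next
      case False
      then have IH: "real (n + 1) * \<bar>noise_weight b c n k\<bar> \<le> b * (-c) ^ min n N" and "k \<le> n"
        using Suc by auto
      have "real (Suc n + 1) * \<bar>noise_weight b c (Suc n) k\<bar>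
          = \<bar>real (n + 2) + c\<bar> / real (n + 1) * (real (n + 1) * \<bar>noise_weight b c n k\<bar>)"
      proof -
        have "1 + c / real (n + 2) = (real (n + 2) + c) / real (n + 2)"
          by (simp add: field_simps)
        then show ?thesis
          using \<open>k \<le> n\<close> by (simp add: noise_weight_Suc abs_mult)
      qed
      also have "\<dots> \<le> \<bar>real (n + 2) + c\<bar> / real (n + 1) * (b * (-c) ^ min n N)"
        by (intro mult_left_mono IH) auto
      also have "\<dots> \<le> b * (-c) ^ min (Suc n) N"
      proof (cases "n < N")
        case True
        have "\<bar>real (n + 2) + c\<bar> \<le> -c * real (n + 1)"
        proof (cases "real (n + 2) + c \<ge> 0")
          case True
          have "real (n + 2) + c \<le> real (n + 1)" using assms by simp
          also have "\<dots> \<le> -c * real (n + 1)"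
            using mult_right_mono[of 1 "-c" "real (n + 1)"] assms by simp
          finally show ?thesis using True by simp
        next
          case False
          have "-c \<le> -c * real (n + 1)"
            using mult_left_mono[of 1 "real (n + 1)" "-c"] assms by simp
          then show ?thesis using False by linarith
        qed
        then have "\<bar>real (n + 2) + c\<bar> / real (n + 1) \<le> -c" by (simp add: field_simps)
        then have "\<bar>real (n + 2) + c\<bar> / real (n + 1) * (b * (-c) ^ n) \<le> -c * (b * (-c) ^ n)"
          by (rule mult_right_mono) (use assms in auto)
        then show ?thesis using True by (simp add: mult_ac)
      next
        case False
        then have "\<bar>real (n + 2) + c\<bar> / real (n + 1) \<le> 1" using N assms by simp
        then have "\<bar>real (n + 2) + c\<bar> / real (n + 1) * (b * (-c) ^ N) \<le> 1 * (b * (-c) ^ N)"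
          by (rule mult_right_mono) (use assms in auto)
        then show ?thesis using False by simp
      qed
      finally show ?thesis .
    qed
  qed
  show ?thesis
  proof
    show "b * (-c) ^ N > 0" using assms by simp
    fix n k :: nat assume "k \<le> n"
    have "(-c) ^ min n N \<le> (-c) ^ N" by (rule power_increasing) (use assms in auto)
    then have "b * (-c) ^ min n N \<le> b * (-c) ^ N" using assms by simp
    with step[OF \<open>k \<le> n\<close>] show "\<bar>noise_weight b c n k\<bar> \<le> b * (-c) ^ N / real (n + 1)"
      by (simp add: field_simps)
  qed
qed

text \<open>
  The sums \<open>s n\<close> of squared weights satisfy
  \<open>s (n + 1) = (1 + c / (n + 2))\<^sup>2 * s n + b\<^sup>2 / (n + 2)\<^sup>2\<close>: each step loses a fraction of about
  \<open>-2 * c / n\<close> and gains \<open>b\<^sup>2 / n\<^sup>2\<close>, so \<open>s n\<close> cannot fall below the order \<open>1 / n\<close>.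
\<close>

lemma sum_noise_weight_sq_lower_bound:
  assumes "b > 0" "c \<le> -1"
  obtains m where "m > 0" "\<And>n. (\<Sum>k\<le>n. (noise_weight b c n k)\<^sup>2) \<ge> m / real (n + 1)"
proof
  define s where "s n = (\<Sum>k\<le>n. (noise_weight b c n k)\<^sup>2)" for n
  \<comment> \<open>\<open>m\<close> is small enough that the gain \<open>b\<^sup>2 / (n + 2)\<close> outweighs the loss \<open>m * (-2 * c - 1) / (n + 1)\<close>.\<close>
  define m where "m = b\<^sup>2 / (4 * (-c))"
  show "m > 0" using assms unfolding m_def by (intro divide_pos_pos) auto
  have m0: "4 * (-c) * m = b\<^sup>2" using assms by (simp add: m_def)
  have "m \<le> -c * m" using mult_right_mono[of 1 "-c" m] assms \<open>m > 0\<close> by simp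
  then have m1: "m \<le> b\<^sup>2 / (2 * (-c))" and m2: "m * (-2 * c - 1) \<le> b\<^sup>2 / 2" and m3: "m \<le> b\<^sup>2"
    using assms m0 \<open>m > 0\<close> by (simp_all only: pos_le_divide_eq) (auto simp: algebra_simps)
  have rec: "s (Suc n) = (1 + c / real (n + 2))\<^sup>2 * s n + b\<^sup>2 / (real (n + 2))\<^sup>2" for n
  proof -
    have "(\<Sum>k\<le>n. (noise_weight b c (Suc n) k)\<^sup>2)
        = (\<Sum>k\<le>n. (1 + c / real (n + 2))\<^sup>2 * (noise_weight b c n k)\<^sup>2)"
      by (intro sum.cong) (auto simp: noise_weight_Suc power_mult_distrib)
    then show ?thesis
      by (simp add: s_def noise_weight_diag sum_distrib_left power_divide)
  qed
  show "s n \<ge> m / real (n + 1)" for n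
  proof (induction n)
    case 0
    then show ?case using m3 by (simp add: s_def noise_weight_diag)
  next
    case (Suc n)
    have s0: "s n \<ge> 0" by (simp add: s_def sum_nonneg)
    have gain: "real (n + 2) * (b\<^sup>2 / (real (n + 2))\<^sup>2) = b\<^sup>2 / real (n + 2)"
      by (simp add: power2_eq_square)
    have "m \<le> real (n + 2) * s (Suc n)"
    proof (cases "real (n + 2) \<ge> -2 * c")
      case True
      have "real (n + 2) * (1 + c / real (n + 2))\<^sup>2 \<ge> real (n + 2) + 2 * c"
      proof -
        have "N * (1 + c / N)\<^sup>2 = N + 2 * c + c\<^sup>2 / N" if "N > 0" for N :: real
          using that by (simp add: field_simps power2_eq_square)
        from this[of "real (n + 2)"]
        have "real (n + 2) * (1 + c / real (n + 2))\<^sup>2 = real (n + 2) + 2 * c + c\<^sup>2 / real (n + 2)"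
          by simp
        then show ?thesis by simp
      qed
      then have "real (n + 2) * (1 + c / real (n + 2))\<^sup>2 * s n \<ge> (real (n + 2) + 2 * c) * s n"
        using s0 by (rule mult_right_mono)
      moreover have "(real (n + 2) + 2 * c) * s n \<ge> (real (n + 2) + 2 * c) * (m / real (n + 1))"
        by (rule mult_left_mono[OF Suc.IH]) (use True in simp)
      moreover have "(real (n + 2) + 2 * c) * (m / real (n + 1)) + b\<^sup>2 / real (n + 2) \<ge> m"
      proof -
        have "(real (n + 2) + 2 * c) * (m / real (n + 1)) = m - m * (-2 * c - 1) / real (n + 1)"
          by (simp add: field_simps)
        moreover have "m * (-2 * c - 1) / real (n + 1) \<le> b\<^sup>2 / 2 / real (n + 1)"
          by (rule divide_right_mono[OF m2]) simp
        moreover have "b\<^sup>2 / 2 / real (n + 1) \<le> b\<^sup>2 / real (n + 2)"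
          using assms by (simp add: field_simps)
        ultimately show ?thesis by linarith
      qed
      moreover have "real (n + 2) * s (Suc n)
          = real (n + 2) * (1 + c / real (n + 2))\<^sup>2 * s n + b\<^sup>2 / real (n + 2)"
        unfolding rec distrib_left gain by simp
      ultimately show ?thesis by linarith
    next
      case False
      have "b\<^sup>2 / (2 * (-c)) \<le> b\<^sup>2 / real (n + 2)"
        using False by (intro frac_le) auto
      moreover have "real (n + 2) * s (Suc n)
          = real (n + 2) * (1 + c / real (n + 2))\<^sup>2 * s n + b\<^sup>2 / real (n + 2)"
        unfolding rec distrib_left gain by simp
      moreover have "real (n + 2) * (1 + c / real (n + 2))\<^sup>2 * s n \<ge> 0"
        using s0 by simp
      ultimately show ?thesis using m1 by linarith
    qed
    then show ?case by (simp add: field_simps)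
  qed
qed

text \<open>
  The weights are of order at most \<open>1 / n\<close> and their Euclidean norm is of order at least
  \<open>1 / sqrt n\<close>. So after normalisation each single weight is \<open>O(1 / sqrt n)\<close>: no single noise
  variable contributes visibly to the weighted sum.
\<close>

lemma normalised_noise_weights:
  assumes "b > 0" "c \<le> -1"
  obtains C where "C > 0"
    "\<And>n. h_norm b c n > 0"
    "\<And>n k. k \<le> n \<Longrightarrow> h_norm b c n * \<bar>noise_weight b c n k\<bar> \<le> C / sqrt (real (n + 1))"
    "\<And>n. (\<Sum>k\<le>n. (h_norm b c n * noise_weight b c n k)\<^sup>2) = 1"
proof -
  obtain C where C: "C > 0" "\<And>n k. k \<le> n \<Longrightarrow> \<bar>noise_weight b c n k\<bar> \<le> C / real (n + 1)"
    using noise_weight_bound[OF assms] by blast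
  obtain m where m: "m > 0" "\<And>n. (\<Sum>k\<le>n. (noise_weight b c n k)\<^sup>2) \<ge> m / real (n + 1)"
    using sum_noise_weight_sq_lower_bound[OF assms] by blast
  have spos: "(\<Sum>k\<le>n. (noise_weight b c n k)\<^sup>2) > 0" for n
    using m(1) by (intro less_le_trans[OF _ m(2)]) simp
  show ?thesis
  proof
    show "C / sqrt m > 0" using C m by simp
    show hpos: "h_norm b c n > 0" for n using spos[of n] by (simp add: h_norm_eq)
    show "h_norm b c n * \<bar>noise_weight b c n k\<bar> \<le> C / sqrt m / sqrt (real (n + 1))"
      if "k \<le> n" for n k
    proof -
      have "h_norm b c n \<le> 1 / sqrt (m / real (n + 1))"
        unfolding h_norm_eq using m by (intro divide_left_mono real_sqrt_le_mono mult_pos_pos)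
          (auto intro: spos)
      also have "\<dots> = sqrt (real (n + 1)) / sqrt m" by (simp add: real_sqrt_divide)
      finally have "h_norm b c n * \<bar>noise_weight b c n k\<bar>
          \<le> sqrt (real (n + 1)) / sqrt m * (C / real (n + 1))"
        using C m that by (intro mult_mono) auto
      also have "\<dots> = C / sqrt m * (sqrt (real (n + 1)) / real (n + 1))" by simp
      also have "sqrt (real (n + 1)) / real (n + 1) = 1 / sqrt (real (n + 1))"
        by (simp add: real_div_sqrt field_simps)
      finally show ?thesis by simp
    qed
    show "(\<Sum>k\<le>n. (h_norm b c n * noise_weight b c n k)\<^sup>2) = 1" for n
    proof -
      have "(h_norm b c n)\<^sup>2 = 1 / (\<Sum>k\<le>n. (noise_weight b c n k)\<^sup>2)"
        using spos[of n] by (simp add: h_norm_eq power_divide)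
      moreover have "(\<Sum>k\<le>n. (h_norm b c n * noise_weight b c n k)\<^sup>2)
          = (h_norm b c n)\<^sup>2 * (\<Sum>k\<le>n. (noise_weight b c n k)\<^sup>2)"
        by (simp add: power_mult_distrib sum_distrib_left)
      ultimately show ?thesis using spos[of n] by simp
    qed
  qed
qed

section \<open>Elementary estimates\<close>

text \<open>
  The cubic remainder of the exponential series is absorbed in the quadratic term, because
  \<open>exp 1 / 6 \<le> 1 / 2\<close>.
\<close>

lemma exp_quadratic_bounds:
  fixes x d :: real
  assumes "\<bar>x\<bar> \<le> d" "d \<le> 1"
  shows "1 + x + (1 - d) / 2 * x\<^sup>2 \<le> exp x" "exp x \<le> 1 + x + (1 + d) / 2 * x\<^sup>2"
proof -
  obtain t where t: "\<bar>t\<bar> \<le> \<bar>x\<bar>" "exp x = (\<Sum>m<3. x ^ m / fact m) + exp t / fact 3 * x ^ 3"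
    using Maclaurin_exp_le by blast
  have e: "exp x = 1 + x + x\<^sup>2 / 2 + exp t / 6 * x ^ 3"
    using t(2) by (simp add: eval_nat_numeral fact_numeral)
  have "exp t \<le> exp 1" using t assms by simp
  then have "exp t \<le> 3" using exp_le by linarith
  then have "\<bar>exp t / 6 * x ^ 3\<bar> \<le> 3 / 6 * \<bar>x\<bar> ^ 3"
    unfolding abs_mult power_abs by (intro mult_mono) auto
  also have "\<dots> = 1 / 2 * x\<^sup>2 * \<bar>x\<bar>" by (simp add: power3_eq_cube power2_eq_square abs_mult_self)
  also have "\<dots> \<le> 1 / 2 * x\<^sup>2 * d" using assms by (intro mult_left_mono) auto
  finally have "\<bar>exp t / 6 * x ^ 3\<bar> \<le> d / 2 * x\<^sup>2" by (simp add: mult_ac)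
  then have "- (d / 2 * x\<^sup>2) \<le> exp t / 6 * x ^ 3" "exp t / 6 * x ^ 3 \<le> d / 2 * x\<^sup>2" by auto
  then show "1 + x + (1 - d) / 2 * x\<^sup>2 \<le> exp x" "exp x \<le> 1 + x + (1 + d) / 2 * x\<^sup>2"
    unfolding e by (simp_all add: field_simps)
qed

lemma sum_inverse_le_sqrt: "(\<Sum>k<n. 1 / real (k + 1)) \<le> 2 * sqrt (real n)"
proof (induction n)
  case (Suc n)
  have "sqrt (real n + 1) * sqrt (real n) \<le> real n + 1 / 2"
  proof -
    have "sqrt (real n + 1) * sqrt (real n) = sqrt ((real n + 1) * real n)"
      by (simp add: real_sqrt_mult)
    also have "\<dots> \<le> sqrt ((real n + 1 / 2)\<^sup>2)"
      by (intro real_sqrt_le_mono) (simp add: power2_eq_square field_simps)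
    finally show ?thesis by simp
  qed
  then have "2 * sqrt (real n) * sqrt (real n + 1) + 1 \<le> 2 * (sqrt (real n + 1) * sqrt (real n + 1))"
    by (simp add: mult_ac)
  then have "2 * sqrt (real n) + 1 / sqrt (real n + 1) \<le> 2 * sqrt (real n + 1)"
    by (simp add: field_simps)
  moreover have "1 / real (n + 1) \<le> 1 / sqrt (real n + 1)"
  proof -
    have "sqrt (real n + 1) \<le> real n + 1" by (rule real_le_lsqrt) (simp_all add: power2_eq_square)
    then show ?thesis by (intro divide_left_mono) auto
  qed
  ultimately show ?case using Suc by (simp add: add.commute)
qed simp

lemma mean_value_segment:
  fixes h :: "real \<Rightarrow> real"
  assumes "\<And>t. (h has_real_derivative h' t) (at t)"
  obtains z where "z \<in> closed_segment x y" "h y - h x = h' z * (y - x)"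
proof (cases x y rule: linorder_cases)
  case less
  then obtain z where "x < z" "z < y" "h y - h x = (y - x) * h' z"
    using MVT2[of x y h h'] assms by auto
  then show ?thesis using that[of z] less by (auto simp: closed_segment_eq_real_ivl mult.commute)
next
  case equal
  then show ?thesis using that[of x] by simp
next
  case greater
  then obtain z where "y < z" "z < x" "h x - h y = (x - y) * h' z"
    using MVT2[of y x h h'] assms by auto
  then show ?thesis using that[of z] greater
    by (auto simp: closed_segment_eq_real_ivl algebra_simps)
qed

text \<open>Two applications of the mean value theorem give the constant \<open>L\<close> instead of the optimal \<open>L / 2\<close>.\<close>

lemma quadratic_remainder_bound:
  fixes h :: "real \<Rightarrow> real"
  assumes h: "\<And>t. (h has_real_derivative h' t) (at t)"
    and h': "\<And>t. (h' has_real_derivative h'' t) (at t)"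
    and L: "\<And>t. \<bar>t\<bar> \<le> B \<Longrightarrow> \<bar>h'' t\<bar> \<le> L"
    and xy: "\<bar>x\<bar> \<le> B" "\<bar>y\<bar> \<le> B"
  shows "\<bar>h y - h x - h' x * (y - x)\<bar> \<le> L * (y - x)\<^sup>2"
proof -
  have segment: "\<bar>w\<bar> \<le> B" if "w \<in> closed_segment v v'" "\<bar>v\<bar> \<le> B" "\<bar>v'\<bar> \<le> B" for v v' w
    using that by (auto simp: closed_segment_eq_real_ivl split: if_splits)
  obtain z where z: "z \<in> closed_segment x y" "h y - h x = h' z * (y - x)"
    using mean_value_segment[OF h] by blast
  obtain w where w: "w \<in> closed_segment x z" "h' z - h' x = h'' w * (z - x)"
    using mean_value_segment[OF h'] by blast
  have "\<bar>h'' w\<bar> \<le> L" using L segment[OF w(1)] segment[OF z(1)] xy by blast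
  moreover have "\<bar>z - x\<bar> \<le> \<bar>y - x\<bar>"
    using z(1) by (auto simp: closed_segment_eq_real_ivl split: if_splits)
  ultimately have "\<bar>h'' w\<bar> * \<bar>z - x\<bar> * \<bar>y - x\<bar> \<le> L * \<bar>y - x\<bar> * \<bar>y - x\<bar>"
    by (intro mult_right_mono mult_mono) auto
  moreover have "h y - h x - h' x * (y - x) = h'' w * (z - x) * (y - x)"
    unfolding z(2) by (simp add: left_diff_distrib flip: w(2))
  ultimately show ?thesis by (simp add: abs_mult power2_eq_square mult.assoc)
qed

section \<open>The drift\<close>

text \<open>
  The derivative determines the sign of \<open>g\<close> on both sides of \<open>x\<close> close to \<open>x\<close>. By the lower bound
  \<open>g\<close> has no zero besides \<open>x\<close>, so these signs persist on the whole half-lines.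
\<close>

lemma stable_point_restoring:
  fixes g :: "real \<Rightarrow> real"
  assumes diff: "\<And>z. g differentiable (at z)"
    and stable: "stable_point g x" and "K1 > 0"
    and lower: "\<And>z. K1 * \<bar>z - x\<bar> \<le> \<bar>g z\<bar>"
  shows "y * g (x + y) \<le> - K1 * y\<^sup>2"
proof -
  have d: "(g has_real_derivative deriv g z) (at z)" for z
    using diff by (simp add: DERIV_deriv_iff_real_differentiable)
  have cont: "isCont g z" for z using d by (rule DERIV_isCont)
  have g0: "g x = 0" "deriv g x < 0" using stable by (auto simp: stable_point_def)
  have nonzero: "g z \<noteq> 0" if "z \<noteq> x" for z
  proof -
    have "0 < K1 * \<bar>z - x\<bar>" using that \<open>K1 > 0\<close> by simp
    also have "\<dots> \<le> \<bar>g z\<bar>" by (rule lower)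
    finally show ?thesis by simp
  qed
  consider "y = 0" | "y > 0" | "y < 0" by linarith
  then show ?thesis
  proof cases
    case 2
    have "g (x + y) < 0"
    proof (rule ccontr)
      assume "\<not> g (x + y) < 0"
      obtain \<delta> where \<delta>: "\<delta> > 0" "\<And>h. 0 < h \<Longrightarrow> h < \<delta> \<Longrightarrow> g (x + h) < 0"
        using DERIV_neg_dec_right[OF d[of x] g0(2)] g0(1) by auto
      define h where "h = min (\<delta> / 2) y"
      have h: "0 < h" "h < \<delta>" "h \<le> y" using \<delta>(1) 2 by (auto simp: h_def)
      obtain z where "x + h \<le> z" "g z = 0"
        using IVT[of g "x + h" 0 "x + y"] \<delta>(2)[OF h(1,2)] \<open>\<not> g (x + y) < 0\<close> h cont by force
      then show False using nonzero[of z] h by auto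
    qed
    then have "g (x + y) \<le> - K1 * y" using lower[of "x + y"] 2 by simp
    then have "y * g (x + y) \<le> y * (- K1 * y)" using 2 by (intro mult_left_mono) auto
    then show ?thesis by (simp add: power2_eq_square mult_ac)
  next
    case 3
    have "g (x + y) > 0"
    proof (rule ccontr)
      assume "\<not> g (x + y) > 0"
      obtain \<delta> where \<delta>: "\<delta> > 0" "\<And>h. 0 < h \<Longrightarrow> h < \<delta> \<Longrightarrow> 0 < g (x - h)"
        using DERIV_neg_dec_left[OF d[of x] g0(2)] g0(1) by auto
      define h where "h = min (\<delta> / 2) (- y)"
      have h: "0 < h" "h < \<delta>" "h \<le> - y" using \<delta>(1) 3 by (auto simp: h_def)
      obtain z where "z \<le> x - h" "g z = 0"
        using IVT[of g "x + y" 0 "x - h"] \<delta>(2)[OF h(1,2)] \<open>\<not> g (x + y) > 0\<close> h cont by force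
      then show False using nonzero[of z] h by auto
    qed
    then have "g (x + y) \<ge> - K1 * y" using lower[of "x + y"] 3 by simp
    then have "y * g (x + y) \<le> y * (- K1 * y)" using 3 by (intro mult_left_mono_neg) auto
    then show ?thesis by (simp add: power2_eq_square mult_ac)
  qed simp
qed

text \<open>
  The first finitely many steps may be so long that they overshoot, but linear growth limits what they
  can do. Afterwards a step contracts towards 0 with the factor \<open>1 - b * K1 / (n + 1)\<close>, and noise of
  size at most \<open>K\<close> cannot drive the trajectory further out once its modulus is at least \<open>K / K1\<close>.
\<close>

lemma mean_reverting_trajectories_bounded:
  fixes f :: "real \<Rightarrow> real"
  assumes "b > 0" "K1 > 0" "K > 0"
    and growth: "\<And>y. \<bar>f y\<bar> \<le> K2 * \<bar>y\<bar>"
    and revert: "\<And>y. y * f y \<le> - K1 * y\<^sup>2"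
  obtains B where "B > 0"
    "\<And>y u n. y 0 = y0 \<Longrightarrow> (\<And>n. y (n + 1) = y n + b / real (n + 1) * (f (y n) + u (n + 1))) \<Longrightarrow>
      (\<And>n. \<bar>u (n + 1)\<bar> \<le> K) \<Longrightarrow> \<bar>y n\<bar> \<le> B"
proof -
  have "K1 \<le> K2" using growth[of 1] revert[of 1] by auto
  then have "K2 > 0" using \<open>K1 > 0\<close> by simp
  obtain N where N: "b * K2 \<le> real N" using real_arch_simple by blast
  define G where "G n = rec_nat \<bar>y0\<bar> (\<lambda>_ z. (1 + b * K2) * z + b * K) n" for n
  have G: "G 0 = \<bar>y0\<bar>" "G (Suc n) = (1 + b * K2) * G n + b * K" for n by (simp_all add: G_def)
  define B where "B = max (G N) (K / K1)"
  have "B > 0" using assms by (simp add: B_def less_max_iff_disj)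
  moreover have "\<bar>y n\<bar> \<le> B"
    if y0: "y 0 = y0" and rec: "\<And>n. y (n + 1) = y n + b / real (n + 1) * (f (y n) + u (n + 1))"
      and u: "\<And>n. \<bar>u (n + 1)\<bar> \<le> K" for y u and n :: nat
  proof -
    have early: "\<bar>y n\<bar> \<le> G n" for n
    proof (induction n)
      case (Suc n)
      define a where "a = b / real (n + 1)"
      have a: "0 \<le> a" "a \<le> b" using assms by (auto simp: a_def field_simps)
      have "\<bar>y (Suc n)\<bar> \<le> \<bar>y n\<bar> + a * (\<bar>f (y n)\<bar> + \<bar>u (n + 1)\<bar>)"
      proof -
        have "y (Suc n) = y n + a * (f (y n) + u (n + 1))" using rec[of n] by (simp add: a_def)
        moreover have "\<bar>a * (f (y n) + u (n + 1))\<bar> \<le> a * (\<bar>f (y n)\<bar> + \<bar>u (n + 1)\<bar>)"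
          unfolding abs_mult using a by (intro mult_mono) auto
        ultimately show ?thesis by linarith
      qed
      also have "\<dots> \<le> \<bar>y n\<bar> + b * (K2 * \<bar>y n\<bar> + K)"
        using a growth[of "y n"] u[of n] by (intro add_left_mono mult_mono add_mono) auto
      also have "\<dots> = (1 + b * K2) * \<bar>y n\<bar> + b * K" by (simp add: algebra_simps)
      also have "\<dots> \<le> G (Suc n)"
        unfolding G using Suc assms \<open>K2 > 0\<close> by (intro add_right_mono mult_left_mono) auto
      finally show ?case .
    qed (simp add: G y0)
    have "mono G"
    proof (rule mono_iff_le_Suc[THEN iffD2, rule_format])
      fix n
      have "0 \<le> G n" using early[of n] by linarith
      then show "G n \<le> G (Suc n)"
        unfolding G using assms \<open>K2 > 0\<close> by (simp add: algebra_simps)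
    qed
    show ?thesis
    proof (cases "n \<le> N")
      case True
      have "\<bar>y n\<bar> \<le> G n" by (rule early)
      also have "\<dots> \<le> G N" using \<open>mono G\<close> True by (rule monoD)
      finally show ?thesis by (simp add: B_def)
    next
      case False
      then have "N \<le> n" by simp
      then show ?thesis
      proof (induction n rule: dec_induct)
        case base
        then show ?case using early[of N] by (simp add: B_def)
      next
        case (step n)
        define a where "a = b / real (n + 1)"
        have a: "0 < a" using assms by (auto simp: a_def field_simps)
        have "b * K2 \<le> real (n + 1)" using N step.hyps by linarith
        then have aK2: "a * K2 \<le> 1" by (simp add: a_def field_simps)
        moreover have "a * K1 \<le> a * K2" using a \<open>K1 \<le> K2\<close> by simp
        ultimately have aK1: "a * K1 \<le> 1" by linarith
        \<comment> \<open>One noiseless step contracts because the step size is small enough not to overshoot.\<close>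
        have contract: "\<bar>z + a * f z\<bar> \<le> (1 - a * K1) * \<bar>z\<bar>" for z
        proof (cases z "0 :: real" rule: linorder_cases)
          case less
          have "z * f z \<le> z * (- K1 * z)" using revert[of z] by (simp add: power2_eq_square mult.left_commute)
          then have "f z \<ge> - K1 * z" unfolding mult_le_cancel_left_neg[OF less] .
          then have "a * f z \<ge> a * (- K1 * z)" using a by (intro mult_left_mono) auto
          moreover have "f z \<le> - K2 * z" using growth[of z] less by simp
          then have "a * f z \<le> a * (- K2 * z)" using a by (intro mult_left_mono) auto
          moreover have "(1 - a * K2) * z \<le> 0" using aK2 less by (simp add: mult_nonneg_nonpos)
          then have "z + a * (- K2 * z) \<le> 0" by (simp add: algebra_simps)
          ultimately have "z + a * (- K1 * z) \<le> z + a * f z" "z + a * f z \<le> 0" by linarith+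
          then have "\<bar>z + a * f z\<bar> \<le> - (z + a * (- K1 * z))" by linarith
          then show ?thesis using less by (simp add: algebra_simps)
        next
          case greater
          have "z * f z \<le> z * (- K1 * z)" using revert[of z] by (simp add: power2_eq_square mult.left_commute)
          then have "f z \<le> - K1 * z" unfolding mult_le_cancel_left_pos[OF greater] .
          then have "a * f z \<le> a * (- K1 * z)" using a by (intro mult_left_mono) auto
          moreover have "f z \<ge> - K2 * z" using growth[of z] greater by simp
          then have "a * f z \<ge> a * (- K2 * z)" using a by (intro mult_left_mono) auto
          moreover have "(1 - a * K2) * z \<ge> 0" using aK2 greater by simp
          then have "0 \<le> z + a * (- K2 * z)" by (simp add: algebra_simps)
          ultimately have "z + a * f z \<le> z + a * (- K1 * z)" "0 \<le> z + a * f z" by linarith+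
          then have "\<bar>z + a * f z\<bar> \<le> z + a * (- K1 * z)" by linarith
          then show ?thesis using greater by (simp add: algebra_simps)
        qed (use growth[of 0] in simp)
        have "\<bar>y (Suc n)\<bar> \<le> \<bar>y n + a * f (y n)\<bar> + a * \<bar>u (n + 1)\<bar>"
        proof -
          have "y (Suc n) = y n + a * f (y n) + a * u (n + 1)"
            using rec[of n] by (simp add: a_def distrib_left)
          then show ?thesis using a by (simp add: abs_mult abs_triangle_ineq[THEN order_trans])
        qed
        also have "\<dots> \<le> (1 - a * K1) * \<bar>y n\<bar> + a * K"
          using contract[of "y n"] u[of n] a by (intro add_mono mult_left_mono) auto
        also have "\<dots> \<le> (1 - a * K1) * B + a * (K1 * B)"
        proof (intro add_mono mult_left_mono)
          have "K / K1 \<le> B" by (simp add: B_def)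
          then show "K \<le> K1 * B" using assms by (simp add: field_simps)
        qed (use step aK1 a in auto)
        also have "\<dots> = B" by (simp add: algebra_simps)
        finally show ?case .
      qed
    qed
  qed
  ultimately show ?thesis using that by blast
qed

text \<open>
  Near 0 the drift \<open>b * f y\<close> is \<open>c * y\<close> with \<open>c < -1\<close>, which makes \<open>y\<^sup>2\<close> decrease at relative rate at
  least 2. Far from 0 only the possibly much smaller rate \<open>b * K1\<close> is available, but a power
  \<open>y ^ (2 * q + 2)\<close> with \<open>q\<close> large decreases \<open>q + 1\<close> times as fast. A sum of the two,
  in which the high power dominates where the linear approximation fails, has relative rate 2
  everywhere.
\<close>

lemma lyapunov_polynomial:
  fixes f :: "real \<Rightarrow> real"
  assumes "b > 0" "c < -1" "K1 > 0" "Ka > 0"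
    and lin: "\<And>y. \<bar>f y - c / b * y\<bar> \<le> Ka * y\<^sup>2"
    and revert: "\<And>y. y * f y \<le> - K1 * y\<^sup>2"
  obtains N q where "N > 0"
    "\<And>y. 2 * (y\<^sup>2 + N * y ^ (2 * q + 2)) \<le> - b * f y * (2 * y + N * real (2 * q + 2) * y ^ (2 * q + 1))"
proof -
  obtain q :: nat where q: "3 / (b * K1) \<le> real q" using real_arch_simple by blast
  \<comment> \<open>Within distance \<open>\<delta>\<close> of 0 the linear approximation still gives relative rate 2 for \<open>y\<^sup>2\<close>; outside, \<open>N * y ^ (2 * q)\<close> is at least 2.\<close>
  define \<delta> where "\<delta> = (- c - 1) / (b * Ka)"
  define N where "N = 2 / \<delta> ^ (2 * q)"
  have "\<delta> > 0" using assms by (simp add: \<delta>_def)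
  then have "N > 0" by (simp add: N_def)
  have "2 * (y\<^sup>2 + N * y ^ (2 * q + 2)) \<le> - b * f y * (2 * y + N * real (2 * q + 2) * y ^ (2 * q + 1))" for y
  proof -
    define w where "w = - b * (y * f y)"
    have y2: "y ^ (2 * q + 1) * y = y ^ (2 * q + 2)" "y ^ (2 * q + 2) = (y ^ (2 * q)) * y\<^sup>2"
      by (simp_all add: power_add power2_eq_square)
    have wK: "w \<ge> b * K1 * y\<^sup>2"
      using mult_left_mono[OF revert[of y], of b] assms by (simp add: w_def mult_ac)
    then have "w \<ge> 0" using assms by (intro order_trans[OF _ wK]) simp
    have rhs: "- b * f y * (2 * y + N * real (2 * q + 2) * y ^ (2 * q + 1))
        = 2 * w + N * y ^ (2 * q) * (real (2 * q + 2) * w)"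
      by (simp add: w_def algebra_simps power_add)
    have "3 \<le> real q * (b * K1)" using q assms by (simp add: field_simps)
    also have "\<dots> \<le> real (2 * q + 2) * (b * K1)" using assms by (intro mult_right_mono) auto
    finally have "3 * y\<^sup>2 \<le> real (2 * q + 2) * (b * K1) * y\<^sup>2" by (rule mult_right_mono) simp
    also have "\<dots> \<le> real (2 * q + 2) * w"
      using mult_left_mono[OF wK, of "real (2 * q + 2)"] by (simp add: mult_ac)
    finally have "N * y ^ (2 * q) * (3 * y\<^sup>2) \<le> N * y ^ (2 * q) * (real (2 * q + 2) * w)"
      using \<open>N > 0\<close> by (intro mult_left_mono) auto
    then have high: "3 * (N * y ^ (2 * q + 2)) \<le> N * y ^ (2 * q) * (real (2 * q + 2) * w)"
      unfolding y2(2) by (simp only: mult_ac)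
    have "0 \<le> N * y ^ (2 * q + 2)" using \<open>N > 0\<close> unfolding y2(2) by simp
    have low: "2 * y\<^sup>2 \<le> 2 * w + N * y ^ (2 * q + 2)"
    proof (cases "\<bar>y\<bar> \<le> \<delta>")
      case True
      have "\<bar>y * (f y - c / b * y)\<bar> \<le> \<bar>y\<bar> * (Ka * y\<^sup>2)"
        unfolding abs_mult by (intro mult_left_mono lin) auto
      also have "\<dots> \<le> \<delta> * (Ka * y\<^sup>2)" using True assms by (intro mult_right_mono) auto
      finally have "b * (y * (f y - c / b * y)) \<le> b * (\<delta> * (Ka * y\<^sup>2))"
        using assms by (intro mult_left_mono) auto
      also have "\<dots> = (- c - 1) * y\<^sup>2" using assms by (simp add: \<delta>_def)
      also have "b * (y * (f y - c / b * y)) = - w - c * y\<^sup>2"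
        using assms by (simp add: w_def power2_eq_square right_diff_distrib)
      finally have "y\<^sup>2 \<le> w" by (simp add: algebra_simps)
      then show ?thesis using \<open>0 \<le> N * y ^ (2 * q + 2)\<close> by linarith
    next
      case False
      then have "\<delta> ^ (2 * q) \<le> \<bar>y\<bar> ^ (2 * q)" using \<open>\<delta> > 0\<close> by (intro power_mono) auto
      then have "2 \<le> N * y ^ (2 * q)" using \<open>\<delta> > 0\<close> by (simp add: N_def field_simps power_even_abs)
      then have "2 * y\<^sup>2 \<le> N * y ^ (2 * q) * y\<^sup>2" by (rule mult_right_mono) simp
      then have "2 * y\<^sup>2 \<le> N * y ^ (2 * q + 2)" unfolding y2(2) by (simp only: mult.assoc)
      then show ?thesis using \<open>w \<ge> 0\<close> by linarith
    qed
    show ?thesis unfolding rhs using high low by (simp add: algebra_simps)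
  qed
  with \<open>N > 0\<close> show ?thesis using that by blast
qed

lemma lyapunov_function:
  fixes f :: "real \<Rightarrow> real"
  assumes "b > 0" "c < -1" "K1 > 0" "Ka > 0" "B > 0"
    and lin: "\<And>y. \<bar>f y - c / b * y\<bar> \<le> Ka * y\<^sup>2"
    and revert: "\<And>y. y * f y \<le> - K1 * y\<^sup>2"
  obtains \<phi> \<phi>' :: "real \<Rightarrow> real" and D L where "D > 0" "L > 0"
    "\<phi> \<in> borel_measurable borel" "\<phi>' \<in> borel_measurable borel"
    "\<And>y. y\<^sup>2 \<le> \<phi> y"
    "\<And>y. 2 * \<phi> y \<le> - b * f y * \<phi>' y"
    "\<And>y. \<bar>y\<bar> \<le> B \<Longrightarrow> \<bar>\<phi>' y\<bar> \<le> D * \<bar>y\<bar>"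
    "\<And>y z. \<bar>y\<bar> \<le> B \<Longrightarrow> \<bar>z\<bar> \<le> B \<Longrightarrow> \<phi> z \<le> \<phi> y + \<phi>' y * (z - y) + L * (z - y)\<^sup>2"
proof -
  obtain N q where N: "N > 0" and
    drift: "\<And>y. 2 * (y\<^sup>2 + N * y ^ (2 * q + 2)) \<le> - b * f y * (2 * y + N * real (2 * q + 2) * y ^ (2 * q + 1))"
    using lyapunov_polynomial[OF assms(1-4) lin revert] by blast
  define \<phi> where "\<phi> y = y\<^sup>2 + N * y ^ (2 * q + 2)" for y :: real
  define \<phi>' where "\<phi>' y = 2 * y + N * real (2 * q + 2) * y ^ (2 * q + 1)" for y :: real
  define \<phi>'' where "\<phi>'' y = 2 + N * real (2 * q + 2) * real (2 * q + 1) * y ^ (2 * q)" for y :: real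
  have d1: "(\<phi> has_real_derivative \<phi>' t) (at t)" for t
    unfolding \<phi>_def \<phi>'_def by (rule derivative_eq_intros refl | simp)+
  have d2: "(\<phi>' has_real_derivative \<phi>'' t) (at t)" for t
    unfolding \<phi>'_def \<phi>''_def by (rule derivative_eq_intros refl | simp)+
  have pow: "\<bar>y\<bar> ^ (2 * q) \<le> B ^ (2 * q)" if "\<bar>y\<bar> \<le> B" for y
    using that by (intro power_mono) auto
  define D where "D = 2 + N * real (2 * q + 2) * B ^ (2 * q)"
  have Dy: "\<bar>\<phi>' y\<bar> \<le> D * \<bar>y\<bar>" if "\<bar>y\<bar> \<le> B" for y
  proof -
    have "\<phi>' y = (2 + N * real (2 * q + 2) * y ^ (2 * q)) * y"
      by (simp add: \<phi>'_def algebra_simps)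
    moreover have "\<bar>2 + N * real (2 * q + 2) * y ^ (2 * q)\<bar> \<le> D"
    proof -
      have "N * real (2 * q + 2) * \<bar>y\<bar> ^ (2 * q) \<le> N * real (2 * q + 2) * B ^ (2 * q)"
        using N pow[OF that] by (intro mult_left_mono) auto
      moreover have "0 \<le> N * real (2 * q + 2) * y ^ (2 * q)" using N by simp
      ultimately show ?thesis by (simp add: D_def power_even_abs)
    qed
    ultimately show ?thesis unfolding abs_mult by (simp add: abs_mult mult_right_mono)
  qed
  define L where "L = 2 + N * real (2 * q + 2) * real (2 * q + 1) * B ^ (2 * q)"
  have L: "\<bar>\<phi>'' y\<bar> \<le> L" if "\<bar>y\<bar> \<le> B" for y
  proof -
    have "N * real (2 * q + 2) * real (2 * q + 1) * \<bar>y\<bar> ^ (2 * q)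
        \<le> N * real (2 * q + 2) * real (2 * q + 1) * B ^ (2 * q)"
      using N pow[OF that] by (intro mult_left_mono) auto
    moreover have "0 \<le> N * real (2 * q + 2) * real (2 * q + 1) * y ^ (2 * q)" using N by simp
    ultimately show ?thesis by (simp add: L_def \<phi>''_def power_even_abs)
  qed
  show ?thesis
  proof
    show "D > 0" "L > 0" using N assms by (auto simp: D_def L_def intro!: add_pos_nonneg)
    show "\<phi> \<in> borel_measurable borel" "\<phi>' \<in> borel_measurable borel"
      unfolding \<phi>_def \<phi>'_def by measurable
    show "y\<^sup>2 \<le> \<phi> y" for y
    proof -
      have "0 \<le> y ^ (2 * q + 2)" by (rule zero_le_even_power) simp
      then show ?thesis using N by (simp add: \<phi>_def)
    qed
    show "2 * \<phi> y \<le> - b * f y * \<phi>' y" for y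
      using drift[of y] by (simp only: \<phi>_def \<phi>'_def)
    show "\<bar>\<phi>' y\<bar> \<le> D * \<bar>y\<bar>" if "\<bar>y\<bar> \<le> B" for y by (rule Dy[OF that])
    show "\<phi> z \<le> \<phi> y + \<phi>' y * (z - y) + L * (z - y)\<^sup>2" if "\<bar>y\<bar> \<le> B" "\<bar>z\<bar> \<le> B" for y z
      using quadratic_remainder_bound[OF d1 d2 L that] by simp
  qed
qed

section \<open>Bounded noise with constant conditional variance\<close>

locale conditional_noise = prob_space M
  for M :: "'a measure" +
  fixes F :: "nat \<Rightarrow> 'a measure" and U :: "nat \<Rightarrow> 'a \<Rightarrow> real" and K \<sigma> :: real
  assumes filt: "filtration (space M) F"
    and subalg: "\<And>n. subalgebra M (F n)"
    and noise_adapted: "\<And>n. U (n + 1) \<in> borel_measurable (F (n + 1))"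
    and K_pos: "K > 0" and \<sigma>_pos: "\<sigma> > 0"
    and noise_bounded: "\<And>n. AE \<omega> in M. \<bar>U (n + 1) \<omega>\<bar> \<le> K"
    and noise_centred: "\<And>n. AE \<omega> in M. real_cond_exp M (F n) (U (n + 1)) \<omega> = 0"
    and noise_variance: "\<And>n. AE \<omega> in M. real_cond_exp M (F n) (\<lambda>\<omega>'. (U (n + 1) \<omega>')\<^sup>2) \<omega> = \<sigma>\<^sup>2"
begin

lemma measurable_F_M: "f \<in> borel_measurable (F n) \<Longrightarrow> f \<in> borel_measurable M"
  by (rule measurable_from_subalg[OF subalg])

lemma measurable_F_mono:
  assumes "m \<le> n" "f \<in> borel_measurable (F m)"
  shows "f \<in> borel_measurable (F n)"
proof (rule measurable_from_subalg[OF _ assms(2)])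
  show "subalgebra (F n) (F m)"
    using filtration.sets_F_mono[OF filt assms(1)] filtration.space_F[OF filt]
    by (simp add: subalgebra_def)
qed

lemma noise_measurable [measurable]: "U (Suc n) \<in> borel_measurable M"
  using measurable_F_M[OF noise_adapted[of n]] by simp

lemma integrable_AE_bounded:
  fixes f :: "'a \<Rightarrow> real"
  assumes "f \<in> borel_measurable M" "AE \<omega> in M. \<bar>f \<omega>\<bar> \<le> C"
  shows "integrable M f"
  by (rule integrable_const_bound[of _ C]) (use assms in auto)

lemma integral_conditional_moment:
  fixes A h :: "'a \<Rightarrow> real"
  assumes A: "A \<in> borel_measurable (F n)" and bA: "AE \<omega> in M. \<bar>A \<omega>\<bar> \<le> C"
    and h: "h \<in> borel_measurable M" and bh: "AE \<omega> in M. \<bar>h \<omega>\<bar> \<le> C'"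
    and ce: "AE \<omega> in M. real_cond_exp M (F n) h \<omega> = e"
  shows "integrable M (\<lambda>\<omega>. A \<omega> * h \<omega>)" "(\<integral>\<omega>. A \<omega> * h \<omega> \<partial>M) = e * (\<integral>\<omega>. A \<omega> \<partial>M)"
proof -
  interpret finite_measure_subalgebra M "F n"
    by unfold_locales (rule subalg)
  note [measurable] = measurable_F_M[OF A] h
  show int: "integrable M (\<lambda>\<omega>. A \<omega> * h \<omega>)"
  proof (rule integrable_AE_bounded)
    show "AE \<omega> in M. \<bar>A \<omega> * h \<omega>\<bar> \<le> C * C'"
      using bA bh by eventually_elim (auto simp: abs_mult intro!: mult_mono)
  qed measurable
  have "(\<integral>\<omega>. A \<omega> * h \<omega> \<partial>M) = (\<integral>\<omega>. A \<omega> * real_cond_exp M (F n) h \<omega> \<partial>M)"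
    using real_cond_exp_intg(2)[OF int A h] by simp
  also have "\<dots> = (\<integral>\<omega>. e * A \<omega> \<partial>M)"
    by (rule integral_cong_AE) (use ce in \<open>auto simp: mult.commute\<close>)
  finally show "(\<integral>\<omega>. A \<omega> * h \<omega> \<partial>M) = e * (\<integral>\<omega>. A \<omega> \<partial>M)" by simp
qed

lemma noise_sq_bounded: "AE \<omega> in M. \<bar>(U (Suc n) \<omega>)\<^sup>2\<bar> \<le> K\<^sup>2"
  using noise_bounded[of n] by eventually_elim (simp add: abs_le_square_iff[symmetric] K_pos less_imp_le)

lemma variance_le_bound_sq: "\<sigma>\<^sup>2 \<le> K\<^sup>2"
proof -
  have "(\<integral>\<omega>. (U (Suc 0) \<omega>)\<^sup>2 \<partial>M) = \<sigma>\<^sup>2"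
    using integral_conditional_moment(2)[where A = "\<lambda>_. 1" and n = 0 and C = 1, OF _ _ _ noise_sq_bounded noise_variance[of 0, simplified]]
    by (simp add: prob_space)
  moreover have "(\<integral>\<omega>. (U (Suc 0) \<omega>)\<^sup>2 \<partial>M) \<le> (\<integral>\<omega>. K\<^sup>2 \<partial>M)"
    by (rule integral_mono_AE) (use noise_sq_bounded[of 0] in \<open>auto intro!: integrable_AE_bounded[of _ "K\<^sup>2"]\<close>)
  ultimately show ?thesis by (simp add: prob_space)
qed

text \<open>
  For small \<open>\<xi> U\<close> the exponential is a quadratic polynomial up to a relative error in its quadratic
  term, and the conditional mean of a quadratic polynomial in the noise is known exactly.
\<close>

lemma conditional_exponential_bounds:
  fixes A \<xi> :: "'a \<Rightarrow> real"
  assumes A: "A \<in> borel_measurable (F n)" and bA: "AE \<omega> in M. 0 \<le> A \<omega> \<and> A \<omega> \<le> C"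
    and \<xi>: "\<xi> \<in> borel_measurable (F n)" and b\<xi>: "AE \<omega> in M. \<bar>\<xi> \<omega>\<bar> * K \<le> d" and d: "d \<le> 1"
  shows "integrable M (\<lambda>\<omega>. A \<omega> * exp (\<xi> \<omega> * U (Suc n) \<omega>))"
    "(\<integral>\<omega>. A \<omega> * (1 + (1 - d) / 2 * (\<xi> \<omega>)\<^sup>2 * \<sigma>\<^sup>2) \<partial>M) \<le> (\<integral>\<omega>. A \<omega> * exp (\<xi> \<omega> * U (Suc n) \<omega>) \<partial>M)"
    "(\<integral>\<omega>. A \<omega> * exp (\<xi> \<omega> * U (Suc n) \<omega>) \<partial>M) \<le> (\<integral>\<omega>. A \<omega> * (1 + (1 + d) / 2 * (\<xi> \<omega>)\<^sup>2 * \<sigma>\<^sup>2) \<partial>M)"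
proof -
  note [measurable] = measurable_F_M[OF A] measurable_F_M[OF \<xi>]
  have small: "AE \<omega> in M. \<bar>\<xi> \<omega> * U (Suc n) \<omega>\<bar> \<le> d"
    using b\<xi> noise_bounded[of n]
  proof eventually_elim
    case (elim \<omega>)
    have "\<bar>\<xi> \<omega>\<bar> * \<bar>U (Suc n) \<omega>\<bar> \<le> \<bar>\<xi> \<omega>\<bar> * K" using elim by (intro mult_left_mono) auto
    then show ?case using elim by (simp add: abs_mult)
  qed
  have b\<xi>': "AE \<omega> in M. \<bar>\<xi> \<omega>\<bar> \<le> d / K"
    using b\<xi> by eventually_elim (use K_pos in \<open>simp add: field_simps\<close>)
  have A\<xi>: "(\<lambda>\<omega>. A \<omega> * \<xi> \<omega>) \<in> borel_measurable (F n)" "(\<lambda>\<omega>. A \<omega> * (\<xi> \<omega>)\<^sup>2) \<in> borel_measurable (F n)"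
    using A \<xi> by measurable
  have bA\<xi>: "AE \<omega> in M. \<bar>A \<omega> * \<xi> \<omega>\<bar> \<le> C * (d / K)"
    using bA b\<xi>' by eventually_elim (auto simp: abs_mult intro!: mult_mono simp del: times_divide_eq_right)
  have bA\<xi>2: "AE \<omega> in M. \<bar>A \<omega> * (\<xi> \<omega>)\<^sup>2\<bar> \<le> C * (d / K)\<^sup>2"
    using bA b\<xi>'
  proof eventually_elim
    case (elim \<omega>)
    then have "\<bar>\<xi> \<omega>\<bar>\<^sup>2 \<le> (d / K)\<^sup>2" by (intro power_mono) auto
    then show ?case using elim unfolding abs_mult by (intro mult_mono) auto
  qed
  have iA: "integrable M A"
    by (rule integrable_AE_bounded[of _ C]) (use bA in auto)
  have iA\<xi>2: "integrable M (\<lambda>\<omega>. A \<omega> * (\<xi> \<omega>)\<^sup>2)"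
    by (rule integrable_AE_bounded[OF _ bA\<xi>2]) measurable
  note m1 = integral_conditional_moment[OF A\<xi>(1) bA\<xi> noise_measurable noise_bounded[of n, simplified]
      noise_centred[of n, simplified]]
  note m2 = integral_conditional_moment[OF A\<xi>(2) bA\<xi>2 _ noise_sq_bounded noise_variance[of n, simplified]]
  have quad: "integrable M (\<lambda>\<omega>. A \<omega> * (1 + \<xi> \<omega> * U (Suc n) \<omega> + q * (\<xi> \<omega> * U (Suc n) \<omega>)\<^sup>2))"
    "(\<integral>\<omega>. A \<omega> * (1 + \<xi> \<omega> * U (Suc n) \<omega> + q * (\<xi> \<omega> * U (Suc n) \<omega>)\<^sup>2) \<partial>M)
      = (\<integral>\<omega>. A \<omega> * (1 + q * (\<xi> \<omega>)\<^sup>2 * \<sigma>\<^sup>2) \<partial>M)" for q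
  proof -
    have e: "A \<omega> * (1 + \<xi> \<omega> * U (Suc n) \<omega> + q * (\<xi> \<omega> * U (Suc n) \<omega>)\<^sup>2)
        = A \<omega> + A \<omega> * \<xi> \<omega> * U (Suc n) \<omega> + q * (A \<omega> * (\<xi> \<omega>)\<^sup>2 * (U (Suc n) \<omega>)\<^sup>2)" for \<omega>
      by (simp add: algebra_simps power_mult_distrib)
    have e': "A \<omega> * (1 + q * (\<xi> \<omega>)\<^sup>2 * \<sigma>\<^sup>2) = A \<omega> + q * \<sigma>\<^sup>2 * (A \<omega> * (\<xi> \<omega>)\<^sup>2)" for \<omega>
      by (simp add: algebra_simps)
    show "integrable M (\<lambda>\<omega>. A \<omega> * (1 + \<xi> \<omega> * U (Suc n) \<omega> + q * (\<xi> \<omega> * U (Suc n) \<omega>)\<^sup>2))"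
      unfolding e using iA m1(1) m2(1) by simp
    show "(\<integral>\<omega>. A \<omega> * (1 + \<xi> \<omega> * U (Suc n) \<omega> + q * (\<xi> \<omega> * U (Suc n) \<omega>)\<^sup>2) \<partial>M)
      = (\<integral>\<omega>. A \<omega> * (1 + q * (\<xi> \<omega>)\<^sup>2 * \<sigma>\<^sup>2) \<partial>M)"
      unfolding e e' using iA iA\<xi>2 m1 m2 by simp
  qed
  show int: "integrable M (\<lambda>\<omega>. A \<omega> * exp (\<xi> \<omega> * U (Suc n) \<omega>))"
  proof (rule integrable_AE_bounded)
    show "AE \<omega> in M. \<bar>A \<omega> * exp (\<xi> \<omega> * U (Suc n) \<omega>)\<bar> \<le> C * exp d"
      using bA small
    proof eventually_elim
      case (elim \<omega>)
      then have "exp (\<xi> \<omega> * U (Suc n) \<omega>) \<le> exp d" by (simp only: exp_le_cancel_iff abs_le_iff)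
      then show ?case using elim unfolding abs_mult by (intro mult_mono) auto
    qed
  qed measurable
  show "(\<integral>\<omega>. A \<omega> * (1 + (1 - d) / 2 * (\<xi> \<omega>)\<^sup>2 * \<sigma>\<^sup>2) \<partial>M) \<le> (\<integral>\<omega>. A \<omega> * exp (\<xi> \<omega> * U (Suc n) \<omega>) \<partial>M)"
    unfolding quad(2)[symmetric]
  proof (rule integral_mono_AE[OF quad(1) int])
    show "AE \<omega> in M. A \<omega> * (1 + \<xi> \<omega> * U (Suc n) \<omega> + (1 - d) / 2 * (\<xi> \<omega> * U (Suc n) \<omega>)\<^sup>2)
        \<le> A \<omega> * exp (\<xi> \<omega> * U (Suc n) \<omega>)"
      using bA small by eventually_elim (intro mult_left_mono exp_quadratic_bounds d, auto)
  qed
  show "(\<integral>\<omega>. A \<omega> * exp (\<xi> \<omega> * U (Suc n) \<omega>) \<partial>M) \<le> (\<integral>\<omega>. A \<omega> * (1 + (1 + d) / 2 * (\<xi> \<omega>)\<^sup>2 * \<sigma>\<^sup>2) \<partial>M)"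
    unfolding quad(2)[symmetric]
  proof (rule integral_mono_AE[OF int quad(1)])
    show "AE \<omega> in M. A \<omega> * exp (\<xi> \<omega> * U (Suc n) \<omega>)
        \<le> A \<omega> * (1 + \<xi> \<omega> * U (Suc n) \<omega> + (1 + d) / 2 * (\<xi> \<omega> * U (Suc n) \<omega>)\<^sup>2)"
      using bA small by eventually_elim (intro mult_left_mono exp_quadratic_bounds d, auto)
  qed
qed

lemma weighted_noise_measurable: "(\<lambda>\<omega>. \<Sum>k<n. v k * U (Suc k) \<omega>) \<in> borel_measurable (F n)"
proof -
  have "U (Suc k) \<in> borel_measurable (F n)" if "k < n" for k
    using measurable_F_mono[of "Suc k" n] noise_adapted[of k] that by simp
  then show ?thesis by (intro borel_measurable_sum borel_measurable_times) auto
qed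

lemma weighted_noise_bounded: "AE \<omega> in M. \<bar>\<Sum>k<n. v k * U (Suc k) \<omega>\<bar> \<le> (\<Sum>k<n. \<bar>v k\<bar> * K)"
proof -
  have "AE \<omega> in M. \<forall>k. \<bar>U (Suc k) \<omega>\<bar> \<le> K"
    using noise_bounded by (simp add: AE_all_countable)
  then show ?thesis
  proof eventually_elim
    case (elim \<omega>)
    have "\<bar>\<Sum>k<n. v k * U (Suc k) \<omega>\<bar> \<le> (\<Sum>k<n. \<bar>v k * U (Suc k) \<omega>\<bar>)" by (rule sum_abs)
    also have "\<dots> \<le> (\<Sum>k<n. \<bar>v k\<bar> * K)"
      using elim by (intro sum_mono) (auto simp: abs_mult intro!: mult_left_mono)
    finally show ?case .
  qed
qed

lemma integrable_exp_weighted_noise: "integrable M (\<lambda>\<omega>. exp (\<Sum>k<n. v k * U (Suc k) \<omega>))"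
proof (rule integrable_AE_bounded)
  show "AE \<omega> in M. \<bar>exp (\<Sum>k<n. v k * U (Suc k) \<omega>)\<bar> \<le> exp (\<Sum>k<n. \<bar>v k\<bar> * K)"
    using weighted_noise_bounded[of v n] by eventually_elim auto
qed measurable

text \<open>
  Peeling off the last noise variable by conditioning shows that deterministically weighted noise
  has, up to factors close to 1 in the exponent, the exponential moments of independent Gaussians.
\<close>

lemma exponential_moment_weighted_noise:
  assumes small: "\<And>k. k < n \<Longrightarrow> \<bar>v k\<bar> * K \<le> d" and d: "0 \<le> d" "d \<le> 1"
  shows "exp ((1 - d)\<^sup>2 * \<sigma>\<^sup>2 / 2 * (\<Sum>k<n. (v k)\<^sup>2)) \<le> (\<integral>\<omega>. exp (\<Sum>k<n. v k * U (Suc k) \<omega>) \<partial>M)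
    \<and> (\<integral>\<omega>. exp (\<Sum>k<n. v k * U (Suc k) \<omega>) \<partial>M) \<le> exp ((1 + d) * \<sigma>\<^sup>2 / 2 * (\<Sum>k<n. (v k)\<^sup>2))"
  using small
proof (induction n)
  case 0
  then show ?case by (simp add: prob_space)
next
  case (Suc n)
  define A where "A \<omega> = exp (\<Sum>k<n. v k * U (Suc k) \<omega>)" for \<omega>
  have Am: "A \<in> borel_measurable (F n)"
    unfolding A_def using weighted_noise_measurable[of v n] by measurable
  have Ab: "AE \<omega> in M. 0 \<le> A \<omega> \<and> A \<omega> \<le> exp (\<Sum>k<n. \<bar>v k\<bar> * K)"
    using weighted_noise_bounded[of v n] by eventually_elim (auto simp: A_def)
  have bv: "AE \<omega> in M. \<bar>v n\<bar> * K \<le> d" using Suc.prems[of n] by simp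
  note bounds = conditional_exponential_bounds[where \<xi> = "\<lambda>_. v n", OF Am Ab _ bv d(2)]
  have IH: "exp ((1 - d)\<^sup>2 * \<sigma>\<^sup>2 / 2 * (\<Sum>k<n. (v k)\<^sup>2)) \<le> (\<integral>\<omega>. A \<omega> \<partial>M)"
    "(\<integral>\<omega>. A \<omega> \<partial>M) \<le> exp ((1 + d) * \<sigma>\<^sup>2 / 2 * (\<Sum>k<n. (v k)\<^sup>2))"
    using Suc.IH Suc.prems by (auto simp: A_def)
  have split: "(\<integral>\<omega>. exp (\<Sum>k<Suc n. v k * U (Suc k) \<omega>) \<partial>M) = (\<integral>\<omega>. A \<omega> * exp (v n * U (Suc n) \<omega>) \<partial>M)"
    by (simp add: A_def exp_add)
  define x where "x = (v n)\<^sup>2 * \<sigma>\<^sup>2"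
  have "x \<le> d"
  proof -
    have "x \<le> (v n)\<^sup>2 * K\<^sup>2" unfolding x_def by (intro mult_left_mono variance_le_bound_sq) simp
    also have "\<dots> = (\<bar>v n\<bar> * K)\<^sup>2" by (simp add: power_mult_distrib)
    also have "\<dots> \<le> d\<^sup>2" using Suc.prems[of n] K_pos by (intro power_mono) auto
    also have "\<dots> \<le> d" using d by (simp add: power2_eq_square mult_left_le)
    finally show ?thesis .
  qed
  have "0 \<le> x" by (simp add: x_def)
  have "exp ((1 - d)\<^sup>2 / 2 * x) \<le> 1 + (1 - d) / 2 * x"
  proof -
    define y where "y = (1 - d) / 2 * x"
    have "(1 - d) / 2 * x \<le> 1 * x" by (rule mult_right_mono) (use d \<open>0 \<le> x\<close> in auto)
    then have y: "0 \<le> y" "y \<le> d" using d \<open>0 \<le> x\<close> \<open>x \<le> d\<close> by (auto simp: y_def)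
    have "(1 - d) * y \<le> y - y\<^sup>2"
      using mult_right_mono[OF y(2) y(1)] by (simp add: algebra_simps power2_eq_square)
    also have "\<dots> \<le> ln (1 + y)" using y d by (intro ln_one_plus_pos_lower_bound) auto
    finally have "exp ((1 - d) * y) \<le> 1 + y" using y by (simp add: ln_ge_iff)
    then show ?thesis by (simp add: y_def power2_eq_square mult_ac)
  qed
  then have "exp ((1 - d)\<^sup>2 * \<sigma>\<^sup>2 / 2 * (\<Sum>k<n. (v k)\<^sup>2)) * exp ((1 - d)\<^sup>2 / 2 * x)
      \<le> (\<integral>\<omega>. A \<omega> \<partial>M) * (1 + (1 - d) / 2 * x)"
    using IH(1)[THEN order_trans[OF exp_ge_zero]] by (intro mult_mono IH) auto
  moreover have "exp ((1 - d)\<^sup>2 * \<sigma>\<^sup>2 / 2 * (\<Sum>k<n. (v k)\<^sup>2)) * exp ((1 - d)\<^sup>2 / 2 * x)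
      = exp ((1 - d)\<^sup>2 * \<sigma>\<^sup>2 / 2 * (\<Sum>k<Suc n. (v k)\<^sup>2))"
    by (simp add: x_def distrib_left mult_ac flip: exp_add)
  ultimately have "exp ((1 - d)\<^sup>2 * \<sigma>\<^sup>2 / 2 * (\<Sum>k<Suc n. (v k)\<^sup>2))
      \<le> (\<integral>\<omega>. A \<omega> \<partial>M) * (1 + (1 - d) / 2 * x)" by simp
  also have "\<dots> \<le> (\<integral>\<omega>. A \<omega> * exp (v n * U (Suc n) \<omega>) \<partial>M)"
    using bounds(2) by (simp add: x_def mult_ac)
  finally have lower: "exp ((1 - d)\<^sup>2 * \<sigma>\<^sup>2 / 2 * (\<Sum>k<Suc n. (v k)\<^sup>2)) \<le> (\<integral>\<omega>. A \<omega> * exp (v n * U (Suc n) \<omega>) \<partial>M)" .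
  have "(\<integral>\<omega>. A \<omega> * exp (v n * U (Suc n) \<omega>) \<partial>M) \<le> (\<integral>\<omega>. A \<omega> \<partial>M) * (1 + (1 + d) / 2 * x)"
    using bounds(3) by (simp add: x_def mult_ac)
  also have "\<dots> \<le> exp ((1 + d) * \<sigma>\<^sup>2 / 2 * (\<Sum>k<n. (v k)\<^sup>2)) * exp ((1 + d) / 2 * x)"
    using d \<open>0 \<le> x\<close> by (intro mult_mono IH exp_ge_add_one_self) auto
  also have "\<dots> = exp ((1 + d) * \<sigma>\<^sup>2 / 2 * (\<Sum>k<Suc n. (v k)\<^sup>2))"
    by (simp add: x_def distrib_left mult_ac flip: exp_add)
  finally show ?case using lower unfolding split by blast
qed

end

section \<open>The sum of squared errors\<close>

context conditional_noise
begin

text \<open>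
  With the Lyapunov function \<open>\<phi>\<close> of rate 2, the process
  \<open>exp (\<theta> * n * \<phi> (Y n) + \<theta> / 2 * (\<Sum>k<n. \<phi> (Y k)))\<close> is almost a supermartingale: in one step
  \<open>n * \<phi> (Y n)\<close> gains one \<open>\<phi> (Y n)\<close> from the growing factor and loses two through the drift. Of the
  remaining loss one half pays for the additional summand and the other half for the fluctuation
  \<open>(\<theta> * b * \<phi>' (Y n) * \<sigma>)\<^sup>2\<close>, which is quadratic in \<open>\<theta>\<close> whereas the loss is linear. Only
  the second order terms of size \<open>1 / (n + 1)\<close> are left.
\<close>

lemma exponential_moment_sum_squares:
  fixes Y :: "nat \<Rightarrow> 'a \<Rightarrow> real" and f :: "real \<Rightarrow> real"
  assumes pos: "b > 0" "c < -1" "K1 > 0" "Ka > 0" "B > 0" "K2 > 0"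
    and growth: "\<And>y. \<bar>f y\<bar> \<le> K2 * \<bar>y\<bar>"
    and lin: "\<And>y. \<bar>f y - c / b * y\<bar> \<le> Ka * y\<^sup>2"
    and revert: "\<And>y. y * f y \<le> - K1 * y\<^sup>2"
    and Ym: "\<And>n. Y n \<in> borel_measurable (F n)"
    and rec: "\<And>n. AE \<omega> in M. Y (n + 1) \<omega> = Y n \<omega> + b / real (n + 1) * (f (Y n \<omega>) + U (n + 1) \<omega>)"
    and YB: "\<And>n. AE \<omega> in M. \<bar>Y n \<omega>\<bar> \<le> B"
  obtains \<kappa> C where "\<kappa> > 0" "C \<ge> 0"
    "\<And>n. integrable M (\<lambda>\<omega>. exp (\<kappa> * (\<Sum>k<n. (Y k \<omega>)\<^sup>2)))"
    "\<And>n. (\<integral>\<omega>. exp (\<kappa> * (\<Sum>k<n. (Y k \<omega>)\<^sup>2)) \<partial>M) \<le> exp (C * (\<Sum>k<n. 1 / real (k + 1)))"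
proof -
  obtain \<phi> \<phi>' :: "real \<Rightarrow> real" and D L where DL: "D > 0" "L > 0"
    and \<phi>m [measurable]: "\<phi> \<in> borel_measurable borel" "\<phi>' \<in> borel_measurable borel"
    and \<phi>_ge: "\<And>y. y\<^sup>2 \<le> \<phi> y"
    and drift: "\<And>y. 2 * \<phi> y \<le> - b * f y * \<phi>' y"
    and \<phi>'_le: "\<And>y. \<bar>y\<bar> \<le> B \<Longrightarrow> \<bar>\<phi>' y\<bar> \<le> D * \<bar>y\<bar>"
    and taylor: "\<And>y z. \<bar>y\<bar> \<le> B \<Longrightarrow> \<bar>z\<bar> \<le> B \<Longrightarrow> \<phi> z \<le> \<phi> y + \<phi>' y * (z - y) + L * (z - y)\<^sup>2"
    using lyapunov_function[OF pos(1-5) lin revert] by (metis (no_types))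
  have \<phi>_nonneg: "0 \<le> \<phi> y" for y using \<phi>_ge[of y] by (meson order_trans zero_le_power2)
  have \<phi>_le: "\<phi> y \<le> L * B\<^sup>2" if "\<bar>y\<bar> \<le> B" for y
  proof -
    have "\<phi>' 0 = 0" using \<phi>'_le[of 0] pos by simp
    moreover have "\<phi> 0 = 0" using drift[of 0] growth[of 0] \<phi>_nonneg[of 0] by simp
    ultimately have "\<phi> y \<le> L * y\<^sup>2" using taylor[of 0 y] that pos by simp
    also have "y\<^sup>2 \<le> B\<^sup>2" using that abs_le_square_iff[of y B] pos by simp
    finally show ?thesis using DL by simp
  qed
  \<comment> \<open>The first bound keeps the exponent \<open>\<theta> * b * \<phi>' (Y n) * U (n + 1)\<close> at most 1 in modulus, the second makes its conditional second moment at most \<open>\<theta> / 2 * \<phi> (Y n)\<close>.\<close>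
  define \<theta> where "\<theta> = min (1 / (b * D * B * K)) (1 / (2 * b\<^sup>2 * D\<^sup>2 * \<sigma>\<^sup>2))"
  have \<theta>: "\<theta> > 0" "\<theta> * (b * D * B * K) \<le> 1" "\<theta> * (2 * b\<^sup>2 * D\<^sup>2 * \<sigma>\<^sup>2) \<le> 1"
  proof -
    have *: "0 < b * D * B * K" "0 < 2 * b\<^sup>2 * D\<^sup>2 * \<sigma>\<^sup>2" using pos DL K_pos \<sigma>_pos by auto
    then show "\<theta> > 0" unfolding \<theta>_def by simp
    have "\<theta> \<le> 1 / (b * D * B * K)" "\<theta> \<le> 1 / (2 * b\<^sup>2 * D\<^sup>2 * \<sigma>\<^sup>2)" by (simp_all add: \<theta>_def)
    then show "\<theta> * (b * D * B * K) \<le> 1" "\<theta> * (2 * b\<^sup>2 * D\<^sup>2 * \<sigma>\<^sup>2) \<le> 1"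
      using * by (simp_all only: pos_le_divide_eq)
  qed
  define H where "H = K2 * B + K"
  define C0 where "C0 = L * b\<^sup>2 * H\<^sup>2"
  have C0: "C0 \<ge> 0" using DL by (simp add: C0_def)
  define V where "V n \<omega> = \<theta> * real n * \<phi> (Y n \<omega>) + \<theta> / 2 * (\<Sum>k<n. \<phi> (Y k \<omega>))" for n \<omega>
  have YF: "Y k \<in> borel_measurable (F n)" if "k \<le> n" for k n
    by (rule measurable_F_mono[OF that Ym])
  have \<phi>YF: "(\<lambda>\<omega>. \<phi> (Y k \<omega>)) \<in> borel_measurable (F n)" if "k \<le> n" for k n
    using measurable_compose[OF YF[OF that] \<phi>m(1)] .
  have VF: "V n \<in> borel_measurable (F n)" for n
    unfolding V_def by (intro borel_measurable_add borel_measurable_times borel_measurable_sum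
      borel_measurable_const \<phi>YF) auto
  have VM [measurable]: "V n \<in> borel_measurable M" for n by (rule measurable_F_M[OF VF])
  have YM [measurable]: "Y n \<in> borel_measurable M" for n by (rule measurable_F_M[OF Ym])
  have YB': "AE \<omega> in M. \<forall>n. \<bar>Y n \<omega>\<bar> \<le> B" using YB by (simp add: AE_all_countable)
  have Vb: "AE \<omega> in M. V n \<omega> \<le> 2 * \<theta> * real n * (L * B\<^sup>2)" for n
    using YB'
  proof eventually_elim
    case (elim \<omega>)
    have "(\<Sum>k<n. \<phi> (Y k \<omega>)) \<le> (\<Sum>k<n. L * B\<^sup>2)"
      using elim by (intro sum_mono \<phi>_le) auto
    then have "\<theta> / 2 * (\<Sum>k<n. \<phi> (Y k \<omega>)) \<le> \<theta> / 2 * (real n * (L * B\<^sup>2))"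
      using \<theta>(1) by (intro mult_left_mono) auto
    moreover have "\<theta> * real n * \<phi> (Y n \<omega>) \<le> \<theta> * real n * (L * B\<^sup>2)"
      using \<theta>(1) elim by (intro mult_left_mono \<phi>_le) auto
    moreover have "0 \<le> \<theta> * real n * (L * B\<^sup>2)" using \<theta>(1) DL by simp
    ultimately show ?case unfolding V_def by (simp add: field_simps)
  qed
  have intV: "integrable M (\<lambda>\<omega>. exp (V n \<omega>))" for n
    by (rule integrable_AE_bounded[of _ "exp (2 * \<theta> * real n * (L * B\<^sup>2))"]) (use Vb[of n] in auto)
  have moment: "(\<integral>\<omega>. exp (V n \<omega>) \<partial>M) \<le> exp (\<theta> * C0 * (\<Sum>k<n. 1 / real (k + 1)))" for n
  proof (induction n)
    case 0
    then show ?case by (simp add: V_def prob_space)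
  next
    case (Suc n)
    define A where "A \<omega> = exp (V n \<omega> - \<theta> / 2 * \<phi> (Y n \<omega>))" for \<omega>
    define \<xi> where "\<xi> \<omega> = \<theta> * b * \<phi>' (Y n \<omega>)" for \<omega>
    have AF: "A \<in> borel_measurable (F n)"
    proof -
      note [measurable] = VF[of n] \<phi>YF[OF order_refl, of n]
      show ?thesis unfolding A_def by measurable
    qed
    have \<xi>F: "\<xi> \<in> borel_measurable (F n)"
    proof -
      note [measurable] = YF[OF order_refl, of n]
      show ?thesis unfolding \<xi>_def by measurable
    qed
    have bA: "AE \<omega> in M. 0 \<le> A \<omega> \<and> A \<omega> \<le> exp (2 * \<theta> * real n * (L * B\<^sup>2))"
      using Vb[of n]
    proof eventually_elim
      case (elim \<omega>)
      have "0 \<le> \<theta> / 2 * \<phi> (Y n \<omega>)" using \<theta>(1) \<phi>_nonneg by simp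
      then show ?case using elim by (simp add: A_def)
    qed
    have b\<xi>: "AE \<omega> in M. \<bar>\<xi> \<omega>\<bar> * K \<le> 1"
      using YB[of n]
    proof eventually_elim
      case (elim \<omega>)
      have "\<bar>\<phi>' (Y n \<omega>)\<bar> \<le> D * B"
        using \<phi>'_le[OF elim] mult_left_mono[OF elim, of D] DL by linarith
      then have "\<theta> * b * \<bar>\<phi>' (Y n \<omega>)\<bar> * K \<le> \<theta> * b * (D * B) * K"
        using \<theta>(1) pos K_pos by (intro mult_right_mono mult_left_mono) auto
      then show ?case using \<theta> pos by (simp add: \<xi>_def abs_mult mult_ac)
    qed
    note bounds = conditional_exponential_bounds[OF AF bA \<xi>F b\<xi> order_refl]
    have "AE \<omega> in M. exp (V (Suc n) \<omega>)
        \<le> exp (\<theta> * C0 / real (n + 1)) * (A \<omega> * exp (\<xi> \<omega> * U (Suc n) \<omega>))"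
      using YB' rec[of n] noise_bounded[of n]
    proof eventually_elim
      case (elim \<omega>)
      define y where "y = Y n \<omega>"
      define z where "z = Y (Suc n) \<omega>"
      define u where "u = U (Suc n) \<omega>"
      define m where "m = real (n + 1)"
      have m: "m > 0" by (simp add: m_def)
      have y: "\<bar>y\<bar> \<le> B" and z: "\<bar>z\<bar> \<le> B" using elim(1) by (simp_all add: y_def z_def)
      have zy: "z - y = b / m * (f y + u)" and u: "\<bar>u\<bar> \<le> K"
        using elim(2,3) by (simp_all add: y_def z_def u_def m_def)
      have "\<bar>f y + u\<bar> \<le> H"
        using growth[of y] mult_left_mono[OF y, of K2] pos u unfolding H_def by linarith
      then have "(f y + u)\<^sup>2 \<le> H\<^sup>2" using power_mono[of "\<bar>f y + u\<bar>" H 2] by simp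
      then have "L * b\<^sup>2 * (f y + u)\<^sup>2 \<le> C0" using DL unfolding C0_def by (intro mult_left_mono) auto
      then have "L * b\<^sup>2 * (f y + u)\<^sup>2 / m \<le> C0 / m" using m by (intro divide_right_mono) auto
      moreover have "m * (L * (z - y)\<^sup>2) = L * b\<^sup>2 * (f y + u)\<^sup>2 / m"
        using m unfolding zy power_mult_distrib power_divide by (simp add: power2_eq_square)
      ultimately have second: "m * (L * (z - y)\<^sup>2) \<le> C0 / m" by simp
      have "m * \<phi> z \<le> m * (\<phi> y + \<phi>' y * (z - y) + L * (z - y)\<^sup>2)"
        using taylor[OF y z] m by (intro mult_left_mono) auto
      also have "\<dots> = m * \<phi> y + b * f y * \<phi>' y + b * \<phi>' y * u + m * (L * (z - y)\<^sup>2)"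
        using m by (simp add: zy algebra_simps)
      also have "\<dots> \<le> m * \<phi> y - 2 * \<phi> y + b * \<phi>' y * u + C0 / m"
        using drift[of y] second by linarith
      finally have "\<theta> * (m * \<phi> z) \<le> \<theta> * (m * \<phi> y - 2 * \<phi> y + b * \<phi>' y * u + C0 / m)"
        using \<theta>(1) by (intro mult_left_mono) auto
      then have "V (Suc n) \<omega> \<le> \<theta> * C0 / m + (V n \<omega> - \<theta> / 2 * \<phi> y + \<theta> * b * \<phi>' y * u)"
        unfolding V_def by (simp add: m_def y_def z_def algebra_simps)
      then show ?case
        by (simp add: A_def \<xi>_def y_def u_def m_def flip: exp_add)
    qed
    then have "(\<integral>\<omega>. exp (V (Suc n) \<omega>) \<partial>M)
        \<le> (\<integral>\<omega>. exp (\<theta> * C0 / real (n + 1)) * (A \<omega> * exp (\<xi> \<omega> * U (Suc n) \<omega>)) \<partial>M)"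
      by (intro integral_mono_AE intV integrable_mult_right bounds(1))
    also have "\<dots> = exp (\<theta> * C0 / real (n + 1)) * (\<integral>\<omega>. A \<omega> * exp (\<xi> \<omega> * U (Suc n) \<omega>) \<partial>M)"
      by simp
    also have "(\<integral>\<omega>. A \<omega> * exp (\<xi> \<omega> * U (Suc n) \<omega>) \<partial>M) \<le> (\<integral>\<omega>. A \<omega> * (1 + (\<xi> \<omega>)\<^sup>2 * \<sigma>\<^sup>2) \<partial>M)"
      using bounds(3) by simp
    also have "\<dots> \<le> (\<integral>\<omega>. exp (V n \<omega>) \<partial>M)"
    proof (rule integral_mono_AE')
      show "integrable M (\<lambda>\<omega>. exp (V n \<omega>))" by (rule intV)
      show "AE \<omega> in M. A \<omega> * (1 + (\<xi> \<omega>)\<^sup>2 * \<sigma>\<^sup>2) \<le> exp (V n \<omega>)"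
        using YB[of n]
      proof eventually_elim
        case (elim \<omega>)
        have "(\<phi>' (Y n \<omega>))\<^sup>2 \<le> (D * \<bar>Y n \<omega>\<bar>)\<^sup>2"
          using \<phi>'_le[OF elim] power_mono[of "\<bar>\<phi>' (Y n \<omega>)\<bar>" "D * \<bar>Y n \<omega>\<bar>" 2] by simp
        also have "\<dots> \<le> D\<^sup>2 * \<phi> (Y n \<omega>)"
          using mult_left_mono[OF \<phi>_ge[of "Y n \<omega>"], of "D\<^sup>2"] by (simp add: power_mult_distrib)
        finally have "\<theta>\<^sup>2 * b\<^sup>2 * \<sigma>\<^sup>2 * (\<phi>' (Y n \<omega>))\<^sup>2 \<le> \<theta>\<^sup>2 * b\<^sup>2 * \<sigma>\<^sup>2 * (D\<^sup>2 * \<phi> (Y n \<omega>))"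
          by (intro mult_left_mono) auto
        also have "\<dots> = \<theta> * (2 * b\<^sup>2 * D\<^sup>2 * \<sigma>\<^sup>2) * (\<theta> / 2 * \<phi> (Y n \<omega>))"
          by (simp add: power2_eq_square)
        also have "\<dots> \<le> 1 * (\<theta> / 2 * \<phi> (Y n \<omega>))"
          using \<theta> \<phi>_nonneg by (intro mult_right_mono) auto
        finally have "(\<xi> \<omega>)\<^sup>2 * \<sigma>\<^sup>2 \<le> \<theta> / 2 * \<phi> (Y n \<omega>)"
          by (simp add: \<xi>_def power_mult_distrib mult_ac)
        then have "1 + (\<xi> \<omega>)\<^sup>2 * \<sigma>\<^sup>2 \<le> exp (\<theta> / 2 * \<phi> (Y n \<omega>))"
          by (intro order_trans[OF exp_ge_add_one_self]) simp
        then have "A \<omega> * (1 + (\<xi> \<omega>)\<^sup>2 * \<sigma>\<^sup>2) \<le> A \<omega> * exp (\<theta> / 2 * \<phi> (Y n \<omega>))"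
          by (intro mult_left_mono) (simp_all add: A_def)
        then show ?case by (simp add: A_def flip: exp_add)
      qed
    qed (simp add: AE_I2)
    also have "\<dots> \<le> exp (\<theta> * C0 * (\<Sum>k<n. 1 / real (k + 1)))" by (rule Suc.IH)
    also have "exp (\<theta> * C0 / real (n + 1)) * exp (\<theta> * C0 * (\<Sum>k<n. 1 / real (k + 1)))
        = exp (\<theta> * C0 * (\<Sum>k<Suc n. 1 / real (k + 1)))"
      by (simp add: distrib_left add.commute flip: exp_add)
    finally show ?case by (simp add: mult_left_mono)
  qed
  have le_V: "exp (\<theta> / 2 * (\<Sum>k<n. (Y k \<omega>)\<^sup>2)) \<le> exp (V n \<omega>)" for n \<omega>
  proof -
    have "\<theta> / 2 * (\<Sum>k<n. (Y k \<omega>)\<^sup>2) \<le> \<theta> / 2 * (\<Sum>k<n. \<phi> (Y k \<omega>))"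
      using \<theta>(1) by (intro mult_left_mono sum_mono \<phi>_ge) auto
    moreover have "0 \<le> \<theta> * real n * \<phi> (Y n \<omega>)" using \<theta>(1) \<phi>_nonneg by simp
    ultimately show ?thesis by (simp add: V_def)
  qed
  have int: "integrable M (\<lambda>\<omega>. exp (\<theta> / 2 * (\<Sum>k<n. (Y k \<omega>)\<^sup>2)))" for n
    by (rule Bochner_Integration.integrable_bound[OF intV[of n]]) (use le_V in auto)
  show ?thesis
  proof
    show "\<theta> / 2 > 0" "\<theta> * C0 \<ge> 0" using \<theta> C0 by auto
    show "integrable M (\<lambda>\<omega>. exp (\<theta> / 2 * (\<Sum>k<n. (Y k \<omega>)\<^sup>2)))" for n by (rule int)
    show "(\<integral>\<omega>. exp (\<theta> / 2 * (\<Sum>k<n. (Y k \<omega>)\<^sup>2)) \<partial>M) \<le> exp (\<theta> * C0 * (\<Sum>k<n. 1 / real (k + 1)))" for n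
      using integral_mono[OF int intV le_V] moment[of n] by (rule order_trans)
  qed
qed

end

section \<open>From exponential moments to moderate deviations\<close>

lemma (in prob_space) chernoff_bound:
  fixes Z :: "'a \<Rightarrow> real"
  assumes "s \<ge> 0" and int: "integrable M (\<lambda>\<omega>. exp (s * Z \<omega>))" and [measurable]: "Z \<in> borel_measurable M"
  shows "prob {\<omega> \<in> space M. Z \<omega> \<ge> a} \<le> exp (- s * a) * (\<integral>\<omega>. exp (s * Z \<omega>) \<partial>M)"
proof -
  have "prob {\<omega> \<in> space M. Z \<omega> \<ge> a} \<le> prob {\<omega> \<in> space M. exp (s * Z \<omega>) \<ge> exp (s * a)}"
    using assms(1) by (intro finite_measure_mono) (auto intro: mult_left_mono)
  also have "\<dots> \<le> (\<integral>\<omega>. exp (s * Z \<omega>) \<partial>M) / exp (s * a)"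
    by (rule integral_Markov_inequality_measure[OF int]) auto
  finally show ?thesis by (simp add: exp_minus field_simps)
qed

lemma eventually_le_exp_speed:
  fixes \<beta> :: "nat \<Rightarrow> real"
  assumes "filterlim \<beta> at_top sequentially" "\<epsilon> > 0"
  shows "eventually (\<lambda>n. C \<le> exp (\<epsilon> * (\<beta> n)\<^sup>2)) sequentially"
proof -
  have "eventually (\<lambda>n. max 1 (C / \<epsilon>) \<le> \<beta> n) sequentially"
    using assms(1) unfolding filterlim_at_top by blast
  then show ?thesis
  proof eventually_elim
    case (elim n)
    have "C / \<epsilon> \<le> \<beta> n" "1 \<le> \<beta> n" using elim by auto
    moreover have "\<beta> n \<le> (\<beta> n)\<^sup>2" using \<open>1 \<le> \<beta> n\<close> by (simp add: power2_eq_square)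
    ultimately have "C / \<epsilon> \<le> (\<beta> n)\<^sup>2" by linarith
    then have "C \<le> \<epsilon> * (\<beta> n)\<^sup>2" using assms(2) by (simp add: field_simps)
    also have "\<dots> \<le> exp (\<epsilon> * (\<beta> n)\<^sup>2)" by (rule order_trans[OF _ exp_ge_add_one_self]) simp
    finally show ?case .
  qed
qed

text \<open>
  This is the hypothesis of the Gaertner-Ellis theorem for \<open>S n / \<beta> n\<close> at speed \<open>(\<beta> n)\<^sup>2\<close>, with the limit
  \<open>t\<^sup>2 * v / 2\<close> of a centred Gaussian of variance \<open>v\<close>. For this quadratic limit the conclusion
  has a direct proof.
\<close>

locale gaussian_log_moments = prob_space M
  for M :: "'a measure" +
  fixes S :: "nat \<Rightarrow> 'a \<Rightarrow> real" and \<beta> :: "nat \<Rightarrow> real" and v :: real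
  assumes S_measurable [measurable]: "\<And>n. S n \<in> borel_measurable M"
    and speed: "filterlim \<beta> at_top sequentially"
    and v_pos: "v > 0"
    and integrable_exp: "\<And>n t. integrable M (\<lambda>\<omega>. exp (t * S n \<omega>))"
    and log_moments: "\<And>t \<epsilon>. \<epsilon> > 0 \<Longrightarrow> eventually (\<lambda>n.
      exp ((t\<^sup>2 * v / 2 - \<epsilon>) * (\<beta> n)\<^sup>2) \<le> (\<integral>\<omega>. exp (t * \<beta> n * S n \<omega>) \<partial>M) \<and>
      (\<integral>\<omega>. exp (t * \<beta> n * S n \<omega>) \<partial>M) \<le> exp ((t\<^sup>2 * v / 2 + \<epsilon>) * (\<beta> n)\<^sup>2)) sequentially"
begin

lemma speed_pos: "eventually (\<lambda>n. \<beta> n > 0) sequentially"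
  using speed by (simp add: filterlim_at_top_dense)

text \<open>The parameter \<open>t = r / v\<close> minimises the exponent \<open>t\<^sup>2 * v / 2 - t * r\<close> of Chernoff's bound.\<close>

lemma tail_upper_bound:
  assumes "r > 0" "\<epsilon> > 0"
  shows "eventually (\<lambda>n. prob {\<omega> \<in> space M. S n \<omega> \<ge> r * \<beta> n}
    \<le> exp (- (r\<^sup>2 / (2 * v) - \<epsilon>) * (\<beta> n)\<^sup>2)) sequentially"
  using log_moments[OF assms(2), of "r / v"] speed_pos
proof eventually_elim
  case (elim n)
  have "prob {\<omega> \<in> space M. S n \<omega> \<ge> r * \<beta> n}
      \<le> exp (- (r / v * \<beta> n) * (r * \<beta> n)) * (\<integral>\<omega>. exp (r / v * \<beta> n * S n \<omega>) \<partial>M)"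
    by (rule chernoff_bound) (use assms v_pos elim integrable_exp[of "r / v * \<beta> n" n] in auto)
  also have "\<dots> \<le> exp (- (r / v * \<beta> n) * (r * \<beta> n)) * exp (((r / v)\<^sup>2 * v / 2 + \<epsilon>) * (\<beta> n)\<^sup>2)"
    using elim by (intro mult_left_mono) auto
  also have "\<dots> = exp (- (r\<^sup>2 / (2 * v) - \<epsilon>) * (\<beta> n)\<^sup>2)"
    using v_pos by (simp add: power2_eq_square field_simps flip: exp_add)
  finally show ?case .
qed

text \<open>
  The exponential moment at \<open>t = (r + \<eta>) / v\<close> comes from values of \<open>S n / \<beta> n\<close> near \<open>t * v = r + \<eta>\<close>:
  the parts below \<open>r\<close> and above \<open>r + 2 * \<eta>\<close> are bounded by the exponential moments at the
  neighbouring parameters \<open>t - s\<close> and \<open>t + s\<close>, and are exponentially smaller than the whole. On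
  what remains, \<open>exp (t * \<beta> n * S n)\<close> is at most \<open>exp (t * (r + 2 * \<eta>) * (\<beta> n)\<^sup>2)\<close>.
\<close>

lemma tail_lower_bound:
  assumes "r > 0" "\<epsilon> > 0"
  shows "eventually (\<lambda>n. exp (- (r\<^sup>2 / (2 * v) + \<epsilon>) * (\<beta> n)\<^sup>2)
    \<le> prob {\<omega> \<in> space M. S n \<omega> > r * \<beta> n}) sequentially"
proof -
  define \<eta> where "\<eta> = min 1 (\<epsilon> * v / (2 * r + 2))"
  have \<eta>: "\<eta> > 0" "\<eta> \<le> 1" "\<eta> * (2 * r + 2) \<le> \<epsilon> * v"
  proof -
    show "\<eta> > 0" "\<eta> \<le> 1" using assms v_pos by (auto simp: \<eta>_def)
    have "\<eta> \<le> \<epsilon> * v / (2 * r + 2)" by (simp add: \<eta>_def)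
    then show "\<eta> * (2 * r + 2) \<le> \<epsilon> * v" using assms by (simp only: pos_le_divide_eq)
  qed
  define t where "t = (r + \<eta>) / v"
  define s where "s = \<eta> / v"
  define R where "R = r + 2 * \<eta>"
  define q where "q = t\<^sup>2 * v / 2"
  \<comment> \<open>The two outer parts lose \<open>\<eta>\<^sup>2 / (2 * v) = 4 * e\<close> in the exponent against the whole, while the moment estimates are exact up to \<open>e\<close>.\<close>
  define e where "e = \<eta>\<^sup>2 / (8 * v)"
  have "e > 0" using \<eta> v_pos by (simp add: e_def)
  have t: "t > 0" "s > 0" using \<eta> v_pos assms by (auto simp: t_def s_def)
  have below: "s * r + ((t - s)\<^sup>2 * v / 2 + e) = q - 3 * e"
    using v_pos by (simp add: t_def s_def q_def e_def field_simps power2_eq_square)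
  have above: "- s * R + ((t + s)\<^sup>2 * v / 2 + e) = q - 3 * e"
    using v_pos by (simp add: t_def s_def q_def e_def R_def field_simps power2_eq_square)
  have "eventually (\<lambda>n. 4 \<le> exp (2 * e * (\<beta> n)\<^sup>2)) sequentially"
    "eventually (\<lambda>n. 2 \<le> exp (e * (\<beta> n)\<^sup>2)) sequentially"
    using \<open>e > 0\<close> by (intro eventually_le_exp_speed speed; simp)+
  then show ?thesis
    using log_moments[OF \<open>e > 0\<close>, of t] log_moments[OF \<open>e > 0\<close>, of "t - s"]
      log_moments[OF \<open>e > 0\<close>, of "t + s"] speed_pos
  proof eventually_elim
    case (elim n)
    define x where "x = (\<beta> n)\<^sup>2"
    define T where "T = {\<omega> \<in> space M. S n \<omega> > r * \<beta> n}"
    have Tm [measurable]: "T \<in> sets M" unfolding T_def by measurable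
    have iT: "integrable M (indicat_real T)" by (rule integrable_const_bound[of _ 1]) auto
    have split: "exp (t * \<beta> n * S n \<omega>) \<le> exp (s * r * x) * exp ((t - s) * \<beta> n * S n \<omega>)
        + exp (- s * R * x) * exp ((t + s) * \<beta> n * S n \<omega>) + exp (t * R * x) * indicator T \<omega>"
      (is "_ \<le> ?A + ?B + ?C") if "\<omega> \<in> space M" for \<omega>
    proof -
      have nonneg: "0 \<le> ?A" "0 \<le> ?B" "0 \<le> ?C" by (simp_all add: indicator_def)
      consider "S n \<omega> \<le> r * \<beta> n" | "R * \<beta> n \<le> S n \<omega>" | "r * \<beta> n < S n \<omega>" "S n \<omega> < R * \<beta> n"
        by linarith
      then show ?thesis
      proof cases
        case 1
        have "s * \<beta> n * S n \<omega> \<le> s * \<beta> n * (r * \<beta> n)" using 1 t elim by (intro mult_left_mono) auto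
        then have "exp (t * \<beta> n * S n \<omega>) \<le> ?A"
          by (simp add: x_def algebra_simps power2_eq_square flip: exp_add)
        then show ?thesis using nonneg by linarith
      next
        case 2
        have "s * \<beta> n * (R * \<beta> n) \<le> s * \<beta> n * S n \<omega>" using 2 t elim by (intro mult_left_mono) auto
        then have "exp (t * \<beta> n * S n \<omega>) \<le> ?B"
          by (simp add: x_def algebra_simps power2_eq_square flip: exp_add)
        then show ?thesis using nonneg by linarith
      next
        case 3
        have "t * \<beta> n * S n \<omega> \<le> t * \<beta> n * (R * \<beta> n)" using 3 t elim by (intro mult_left_mono) auto
        then have "exp (t * \<beta> n * S n \<omega>) \<le> ?C"
          using 3 that by (simp add: T_def x_def mult_ac power2_eq_square)
        then show ?thesis using nonneg by linarith
      qed
    qed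
    have "(\<integral>\<omega>. exp (t * \<beta> n * S n \<omega>) \<partial>M)
        \<le> (\<integral>\<omega>. exp (s * r * x) * exp ((t - s) * \<beta> n * S n \<omega>)
          + exp (- s * R * x) * exp ((t + s) * \<beta> n * S n \<omega>) + exp (t * R * x) * indicator T \<omega> \<partial>M)"
      by (intro integral_mono split integrable_exp Bochner_Integration.integrable_add
          integrable_mult_right iT)
    also have "\<dots> = exp (s * r * x) * (\<integral>\<omega>. exp ((t - s) * \<beta> n * S n \<omega>) \<partial>M)
        + exp (- s * R * x) * (\<integral>\<omega>. exp ((t + s) * \<beta> n * S n \<omega>) \<partial>M) + exp (t * R * x) * prob T"
      using integrable_exp iT by (simp add: Bochner_Integration.integral_add)
    also have "\<dots> \<le> exp (s * r * x) * exp (((t - s)\<^sup>2 * v / 2 + e) * x)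
        + exp (- s * R * x) * exp (((t + s)\<^sup>2 * v / 2 + e) * x) + exp (t * R * x) * prob T"
      using elim by (intro add_mono mult_left_mono) (auto simp: x_def)
    also have "exp (s * r * x) * exp (((t - s)\<^sup>2 * v / 2 + e) * x) = exp ((q - 3 * e) * x)"
      by (simp only: below distrib_right[symmetric] exp_add[symmetric])
    also have "exp (- s * R * x) * exp (((t + s)\<^sup>2 * v / 2 + e) * x) = exp ((q - 3 * e) * x)"
      by (simp only: above distrib_right[symmetric] exp_add[symmetric])
    finally have main: "exp ((q - e) * x) \<le> 2 * exp ((q - 3 * e) * x) + exp (t * R * x) * prob T"
      using elim unfolding q_def x_def by linarith
    have "4 * exp ((q - 3 * e) * x) \<le> exp (2 * e * x) * exp ((q - 3 * e) * x)"
      using elim by (intro mult_right_mono) (auto simp: x_def)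
    also have "\<dots> = exp ((q - e) * x)" by (simp add: algebra_simps flip: exp_add)
    finally have "exp ((q - e) * x) \<le> 2 * (exp (t * R * x) * prob T)" using main by linarith
    moreover have "2 * exp ((q - 2 * e) * x) \<le> exp (e * x) * exp ((q - 2 * e) * x)"
      using elim by (intro mult_right_mono) (auto simp: x_def)
    moreover have "exp (e * x) * exp ((q - 2 * e) * x) = exp ((q - e) * x)"
      by (simp add: algebra_simps flip: exp_add)
    ultimately have "exp ((q - 2 * e) * x) \<le> exp (t * R * x) * prob T" by linarith
    then have "exp (- (t * R * x)) * exp ((q - 2 * e) * x) \<le> prob T"
      by (simp add: exp_minus field_simps)
    then have "exp ((q - 2 * e - t * R) * x) \<le> prob T"
      by (simp add: algebra_simps flip: exp_add)
    moreover have "- (r\<^sup>2 / (2 * v) + \<epsilon>) * x \<le> (q - 2 * e - t * R) * x"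
    proof (rule mult_right_mono)
      have "\<eta>\<^sup>2 \<le> \<eta>" using \<eta> by (simp add: power2_eq_square mult_left_le)
      have "v * (q - 2 * e - t * R) = - (r\<^sup>2 / 2) - 2 * r * \<eta> - 7 / 4 * \<eta>\<^sup>2"
        using v_pos by (simp add: q_def t_def e_def R_def field_simps power2_eq_square)
      also have "\<dots> \<ge> - (r\<^sup>2 / 2) - \<eta> * (2 * r + 2)"
        using \<open>\<eta>\<^sup>2 \<le> \<eta>\<close> \<eta>(1) unfolding distrib_left by simp
      also have "- (r\<^sup>2 / 2) - \<eta> * (2 * r + 2) \<ge> v * (- (r\<^sup>2 / (2 * v) + \<epsilon>))"
      proof -
        have "v * (- (r\<^sup>2 / (2 * v) + \<epsilon>)) = - (r\<^sup>2 / 2) - \<epsilon> * v"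
          using v_pos by (simp add: field_simps)
        then show ?thesis using \<eta>(3) by linarith
      qed
      finally show "- (r\<^sup>2 / (2 * v) + \<epsilon>) \<le> q - 2 * e - t * R"
        using v_pos by (simp only: mult_le_cancel_left_pos)
    qed (simp add: x_def)
    ultimately show ?case unfolding T_def x_def by (meson exp_le_cancel_iff order_trans)
  qed
qed

lemma uminus_gaussian_log_moments: "gaussian_log_moments M (\<lambda>n \<omega>. - S n \<omega>) \<beta> v"
proof unfold_locales
  show "integrable M (\<lambda>\<omega>. exp (t * - S n \<omega>))" for n t
    using integrable_exp[of "- t" n] by simp
  show "eventually (\<lambda>n. exp ((t\<^sup>2 * v / 2 - \<epsilon>) * (\<beta> n)\<^sup>2) \<le> (\<integral>\<omega>. exp (t * \<beta> n * - S n \<omega>) \<partial>M) \<and>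
      (\<integral>\<omega>. exp (t * \<beta> n * - S n \<omega>) \<partial>M) \<le> exp ((t\<^sup>2 * v / 2 + \<epsilon>) * (\<beta> n)\<^sup>2)) sequentially"
    if "\<epsilon> > 0" for t \<epsilon>
    using log_moments[OF that, of "- t"] by simp
qed (use speed v_pos in auto)

text \<open>
  An error that exceeds \<open>\<eta> * \<beta> n\<close> only with superexponentially small probability, for each
  \<open>\<eta>\<close>, shifts the level \<open>r\<close> by an arbitrarily small amount and so does not affect the rate.
\<close>

lemma perturbed_two_sided_tail:
  fixes Z E :: "nat \<Rightarrow> 'a \<Rightarrow> real"
  assumes [measurable]: "\<And>n. Z n \<in> borel_measurable M" "\<And>n. E n \<in> borel_measurable M"
    and decomp: "\<And>n. AE \<omega> in M. Z n \<omega> = S n \<omega> + E n \<omega>"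
    and negligible: "\<And>\<eta> L. \<eta> > 0 \<Longrightarrow>
      eventually (\<lambda>n. prob {\<omega> \<in> space M. \<bar>E n \<omega>\<bar> \<ge> \<eta> * \<beta> n} \<le> exp (- L * (\<beta> n)\<^sup>2)) sequentially"
    and "r > 0"
  shows "(\<lambda>n. 1 / (\<beta> n)\<^sup>2 * ln (prob {\<omega> \<in> space M. \<bar>Z n \<omega>\<bar> > r * \<beta> n})) \<longlonglongrightarrow> - (r\<^sup>2 / (2 * v))"
proof -
  define p where "p n = prob {\<omega> \<in> space M. \<bar>Z n \<omega>\<bar> > r * \<beta> n}" for n
  define I where "I = r\<^sup>2 / (2 * v)"
  interpret neg: gaussian_log_moments M "\<lambda>n \<omega>. - S n \<omega>" \<beta> v
    by (rule uminus_gaussian_log_moments)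
  have upper: "eventually (\<lambda>n. p n \<le> exp (- (I - 3 * \<epsilon>) * (\<beta> n)\<^sup>2)) sequentially" if "\<epsilon> > 0" for \<epsilon>
  proof -
    define \<eta> where "\<eta> = min (r / 2) (\<epsilon> * v / r)"
    have "\<eta> \<le> \<epsilon> * v / r" by (simp add: \<eta>_def)
    then have "r * \<eta> \<le> \<epsilon> * v" using \<open>r > 0\<close> by (simp add: field_simps)
    have \<eta>: "\<eta> > 0" "r - \<eta> > 0"
    proof -
      show "\<eta> > 0" using that v_pos \<open>r > 0\<close> by (simp add: \<eta>_def)
      have "\<eta> \<le> r / 2" unfolding \<eta>_def by (rule min.cobounded1)
      then show "r - \<eta> > 0" using \<open>r > 0\<close> by linarith
    qed
    have rate: "(r - \<eta>)\<^sup>2 / (2 * v) - \<epsilon> \<ge> I - 2 * \<epsilon>"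
    proof -
      have "(r - \<eta>)\<^sup>2 \<ge> r\<^sup>2 - 2 * (r * \<eta>)" by (simp add: power2_diff)
      then have "(r - \<eta>)\<^sup>2 \<ge> r\<^sup>2 - 2 * (\<epsilon> * v)" using \<open>r * \<eta> \<le> \<epsilon> * v\<close> by linarith
      then have "(r - \<eta>)\<^sup>2 / (2 * v) \<ge> (r\<^sup>2 - 2 * (\<epsilon> * v)) / (2 * v)"
        using v_pos by (intro divide_right_mono) auto
      then show ?thesis using v_pos by (simp add: I_def diff_divide_distrib)
    qed
    show ?thesis
      using tail_upper_bound[OF \<eta>(2) that] neg.tail_upper_bound[OF \<eta>(2) that]
        negligible[OF \<eta>(1), of "I - 2 * \<epsilon>"] eventually_le_exp_speed[OF speed that, of 3]
    proof eventually_elim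
      case (elim n)
      define x where "x = (\<beta> n)\<^sup>2"
      let ?A = "{\<omega> \<in> space M. S n \<omega> \<ge> (r - \<eta>) * \<beta> n}"
      let ?B = "{\<omega> \<in> space M. - S n \<omega> \<ge> (r - \<eta>) * \<beta> n}"
      let ?C = "{\<omega> \<in> space M. \<bar>E n \<omega>\<bar> \<ge> \<eta> * \<beta> n}"
      have "p n \<le> prob (?A \<union> ?B \<union> ?C)"
        unfolding p_def
      proof (rule finite_measure_mono_AE)
        show "AE \<omega> in M. \<omega> \<in> {\<omega> \<in> space M. \<bar>Z n \<omega>\<bar> > r * \<beta> n} \<longrightarrow> \<omega> \<in> ?A \<union> ?B \<union> ?C"
          using decomp[of n] by eventually_elim (auto simp: left_diff_distrib)
      qed measurable
      also have "\<dots> \<le> prob ?A + prob ?B + prob ?C"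
        by (intro order_trans[OF measure_Un_le] add_right_mono measure_Un_le) measurable
      also have "\<dots> \<le> exp (- (I - 2 * \<epsilon>) * x) + exp (- (I - 2 * \<epsilon>) * x) + exp (- (I - 2 * \<epsilon>) * x)"
      proof -
        have "exp (- ((r - \<eta>)\<^sup>2 / (2 * v) - \<epsilon>) * x) \<le> exp (- (I - 2 * \<epsilon>) * x)"
          using rate by (simp add: x_def mult_right_mono)
        then show ?thesis using elim unfolding x_def by linarith
      qed
      also have "\<dots> = 3 * exp (- (I - 2 * \<epsilon>) * x)" by simp
      also have "\<dots> \<le> exp (\<epsilon> * x) * exp (- (I - 2 * \<epsilon>) * x)"
        using elim by (intro mult_right_mono) (auto simp: x_def)
      also have "\<dots> = exp (- (I - 3 * \<epsilon>) * x)" by (simp add: algebra_simps flip: exp_add)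
      finally show ?case by (simp only: x_def)
    qed
  qed
  have lower: "eventually (\<lambda>n. exp (- (I + 4 * \<epsilon>) * (\<beta> n)\<^sup>2) \<le> p n) sequentially" if "\<epsilon> > 0" for \<epsilon>
  proof -
    define \<eta> where "\<eta> = min r (\<epsilon> * v / r)"
    have "\<eta> \<le> \<epsilon> * v / r" "\<eta> \<le> r" by (simp_all add: \<eta>_def)
    then have "r * \<eta> \<le> \<epsilon> * v" using \<open>r > 0\<close> by (simp add: field_simps)
    have "\<eta> > 0" using that v_pos \<open>r > 0\<close> by (simp add: \<eta>_def)
    then have \<eta>: "\<eta> > 0" "r + \<eta> > 0" using \<open>r > 0\<close> by simp_all
    have rate: "(r + \<eta>)\<^sup>2 / (2 * v) + \<epsilon> \<le> I + 3 * \<epsilon>"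
    proof -
      have "\<eta> * \<eta> \<le> r * \<eta>" using \<open>\<eta> \<le> r\<close> \<eta>(1) by (intro mult_right_mono) auto
      then have "(r + \<eta>)\<^sup>2 \<le> r\<^sup>2 + 4 * (\<epsilon> * v)"
        using \<open>r * \<eta> \<le> \<epsilon> * v\<close> unfolding power2_sum power2_eq_square[of \<eta>] using that v_pos mult_pos_pos[OF that v_pos] by linarith
      then have "(r + \<eta>)\<^sup>2 / (2 * v) \<le> (r\<^sup>2 + 4 * (\<epsilon> * v)) / (2 * v)"
        using v_pos by (intro divide_right_mono) auto
      then show ?thesis using v_pos by (simp add: I_def add_divide_distrib)
    qed
    show ?thesis
      using tail_lower_bound[OF \<eta>(2) that]
        negligible[OF \<eta>(1), of "I + 4 * \<epsilon>"] eventually_le_exp_speed[OF speed that, of 2]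
    proof eventually_elim
      case (elim n)
      define x where "x = (\<beta> n)\<^sup>2"
      let ?C = "{\<omega> \<in> space M. \<bar>E n \<omega>\<bar> \<ge> \<eta> * \<beta> n}"
      let ?Z = "{\<omega> \<in> space M. \<bar>Z n \<omega>\<bar> > r * \<beta> n}"
      have "2 * exp (- (I + 4 * \<epsilon>) * x) \<le> exp (\<epsilon> * x) * exp (- (I + 4 * \<epsilon>) * x)"
        using elim by (intro mult_right_mono) (auto simp: x_def)
      also have "\<dots> = exp (- (I + 3 * \<epsilon>) * x)" by (simp add: algebra_simps flip: exp_add)
      also have "\<dots> \<le> exp (- ((r + \<eta>)\<^sup>2 / (2 * v) + \<epsilon>) * x)"
        unfolding exp_le_cancel_iff using rate by (intro mult_right_mono) (auto simp: x_def)
      also have "\<dots> \<le> prob {\<omega> \<in> space M. S n \<omega> > (r + \<eta>) * \<beta> n}" using elim by (simp only: x_def)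
      also have "\<dots> \<le> prob (?Z \<union> ?C)"
      proof (rule finite_measure_mono_AE)
        show "AE \<omega> in M. \<omega> \<in> {\<omega> \<in> space M. S n \<omega> > (r + \<eta>) * \<beta> n} \<longrightarrow> \<omega> \<in> ?Z \<union> ?C"
          using decomp[of n] by eventually_elim (auto simp: distrib_right)
      qed measurable
      also have "\<dots> \<le> prob ?Z + prob ?C" by (rule measure_Un_le) measurable
      also have "\<dots> \<le> p n + exp (- (I + 4 * \<epsilon>) * x)" using elim by (simp add: p_def x_def)
      finally show ?case unfolding x_def by linarith
    qed
  qed
  show ?thesis
    unfolding p_def[symmetric] I_def[symmetric]
  proof (rule tendstoI)
    fix \<delta> :: real assume "\<delta> > 0"
    then have "\<delta> / 8 > 0" by simp
    show "eventually (\<lambda>n. dist (1 / (\<beta> n)\<^sup>2 * ln (p n)) (- I) < \<delta>) sequentially"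
      using upper[OF \<open>\<delta> / 8 > 0\<close>] lower[OF \<open>\<delta> / 8 > 0\<close>] speed_pos
    proof eventually_elim
      case (elim n)
      have x: "(\<beta> n)\<^sup>2 > 0" using elim by simp
      have p: "p n > 0" using elim(2) by (rule less_le_trans[OF exp_gt_zero])
      have "- (I + 4 * (\<delta> / 8)) * (\<beta> n)\<^sup>2 \<le> ln (p n)" using elim(2) p by (simp only: ln_ge_iff)
      then have l: "- (I + 4 * (\<delta> / 8)) \<le> 1 / (\<beta> n)\<^sup>2 * ln (p n)" using x by (simp add: field_simps)
      have "ln (p n) \<le> - (I - 3 * (\<delta> / 8)) * (\<beta> n)\<^sup>2"
        using elim(1) p by (metis ln_exp ln_le_cancel_iff exp_gt_zero)
      then have "1 / (\<beta> n)\<^sup>2 * ln (p n) \<le> - (I - 3 * (\<delta> / 8))" using x by (simp add: field_simps)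
      then show ?case using l \<open>\<delta> > 0\<close> by (simp only: dist_real_def abs_less_iff) linarith
    qed
  qed
qed

end

section \<open>Moderate deviations of the stochastic approximation\<close>

lemma speed_below_sqrt:
  fixes \<beta> :: "nat \<Rightarrow> real"
  assumes "\<gamma> > 0" "\<beta> \<in> O(\<lambda>n. real n powr (1 / (2 * (1 + \<gamma>))))"
  shows "(\<lambda>n. \<beta> n / sqrt (real (n + 1))) \<longlonglongrightarrow> 0"
proof -
  define p where "p = 1 / (2 * (1 + \<gamma>))"
  have p: "p - 1 / 2 < 0" using assms(1) by (simp add: p_def field_simps)
  obtain C where C: "C > 0" "eventually (\<lambda>n. norm (\<beta> n) \<le> C * norm (real n powr p)) sequentially"
    using assms(2) unfolding p_def[symmetric] by (rule landau_o.bigE)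
  have "(\<lambda>n. C * real n powr (p - 1 / 2)) \<longlonglongrightarrow> C * 0"
    by (intro tendsto_mult tendsto_const tendsto_neg_powr p filterlim_real_sequentially)
  then have lim: "(\<lambda>n. C * real n powr (p - 1 / 2)) \<longlonglongrightarrow> 0" by simp
  show ?thesis
  proof (rule Lim_null_comparison[OF _ lim])
    show "eventually (\<lambda>n. norm (\<beta> n / sqrt (real (n + 1))) \<le> C * real n powr (p - 1 / 2)) sequentially"
      using C(2) eventually_gt_at_top[of 0]
    proof eventually_elim
      case (elim n)
      have "norm (\<beta> n / sqrt (real (n + 1))) \<le> C * real n powr p / sqrt (real n)"
        using elim C(1) by (auto intro!: frac_le)
      also have "\<dots> = C * real n powr (p - 1 / 2)"
        using elim by (simp add: powr_diff powr_half_sqrt)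
      finally show ?case .
    qed
  qed
qed

text \<open>
  In the exponent \<open>t * \<beta> n * v n k * U (k + 1)\<close> every coefficient is \<open>O(\<beta> n / sqrt n)\<close> and tends to 0,
  which makes the exponential moments asymptotically Gaussian.
\<close>

lemma (in conditional_noise) gaussian_log_moments_weighted_noise:
  fixes v :: "nat \<Rightarrow> nat \<Rightarrow> real"
  assumes speed: "filterlim \<beta> at_top sequentially"
    and slow: "(\<lambda>n. \<beta> n / sqrt (real (n + 1))) \<longlonglongrightarrow> 0"
    and "C > 0"
    and small: "\<And>n k. k \<le> n \<Longrightarrow> \<bar>v n k\<bar> \<le> C / sqrt (real (n + 1))"
    and normalised: "\<And>n. (\<Sum>k\<le>n. (v n k)\<^sup>2) = 1"
  shows "gaussian_log_moments M (\<lambda>n \<omega>. \<Sum>k<Suc n. v n k * U (Suc k) \<omega>) \<beta> (\<sigma>\<^sup>2)"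
proof unfold_locales
  show "filterlim \<beta> at_top sequentially" by (rule speed)
  show "\<sigma>\<^sup>2 > 0" using \<sigma>_pos by simp
  have scale: "t * (\<Sum>k<Suc n. v n k * U (Suc k) \<omega>) = (\<Sum>k<Suc n. (t * v n k) * U (Suc k) \<omega>)" for t n \<omega>
    by (simp only: sum_distrib_left mult.assoc)
  show "(\<lambda>\<omega>. \<Sum>k<Suc n. v n k * U (Suc k) \<omega>) \<in> borel_measurable M" for n
    by (rule measurable_F_M[OF weighted_noise_measurable])
  show "integrable M (\<lambda>\<omega>. exp (t * (\<Sum>k<Suc n. v n k * U (Suc k) \<omega>)))" for n t
    unfolding scale by (rule integrable_exp_weighted_noise)
  fix t \<epsilon> :: real assume "\<epsilon> > 0"
  define d where "d = min 1 (\<epsilon> / (t\<^sup>2 * \<sigma>\<^sup>2 + 1))"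
  have d: "d > 0" "d \<le> 1" using \<open>\<epsilon> > 0\<close> by (auto simp: d_def intro!: divide_pos_pos add_nonneg_pos)
  have "d * (t\<^sup>2 * \<sigma>\<^sup>2) \<le> \<epsilon>"
  proof -
    have "0 < t\<^sup>2 * \<sigma>\<^sup>2 + 1" by (intro add_nonneg_pos) auto
    moreover have "d \<le> \<epsilon> / (t\<^sup>2 * \<sigma>\<^sup>2 + 1)" unfolding d_def by (rule min.cobounded2)
    ultimately have "d * (t\<^sup>2 * \<sigma>\<^sup>2 + 1) \<le> \<epsilon>" by (simp only: pos_le_divide_eq)
    then show ?thesis using d(1) by (simp add: distrib_left)
  qed
  have "(\<lambda>n. \<bar>t\<bar> * C * K * (\<beta> n / sqrt (real (n + 1)))) \<longlonglongrightarrow> \<bar>t\<bar> * C * K * 0"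
    by (intro tendsto_intros slow)
  then have "eventually (\<lambda>n. \<bar>t\<bar> * C * K * (\<beta> n / sqrt (real (n + 1))) < d) sequentially"
    using d(1) by (intro order_tendstoD(2)) auto
  moreover have "eventually (\<lambda>n. \<beta> n > 0) sequentially"
    using speed by (simp add: filterlim_at_top_dense)
  ultimately show "eventually (\<lambda>n.
      exp ((t\<^sup>2 * \<sigma>\<^sup>2 / 2 - \<epsilon>) * (\<beta> n)\<^sup>2) \<le> (\<integral>\<omega>. exp (t * \<beta> n * (\<Sum>k<Suc n. v n k * U (Suc k) \<omega>)) \<partial>M) \<and>
      (\<integral>\<omega>. exp (t * \<beta> n * (\<Sum>k<Suc n. v n k * U (Suc k) \<omega>)) \<partial>M) \<le> exp ((t\<^sup>2 * \<sigma>\<^sup>2 / 2 + \<epsilon>) * (\<beta> n)\<^sup>2))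
    sequentially"
  proof eventually_elim
    case (elim n)
    have vk: "\<bar>t * \<beta> n * v n k\<bar> * K \<le> d" if "k < Suc n" for k
    proof -
      have "\<bar>t * \<beta> n * v n k\<bar> * K \<le> \<bar>t\<bar> * \<beta> n * (C / sqrt (real (n + 1))) * K"
        using small[of k n] that elim K_pos by (simp only: abs_mult) (intro mult_right_mono mult_mono, auto)
      also have "\<dots> = \<bar>t\<bar> * C * K * (\<beta> n / sqrt (real (n + 1)))" by simp
      finally show ?thesis using elim by linarith
    qed
    have total: "(\<Sum>k<Suc n. (t * \<beta> n * v n k)\<^sup>2) = t\<^sup>2 * (\<beta> n)\<^sup>2"
    proof -
      have "(\<Sum>k<Suc n. (t * \<beta> n * v n k)\<^sup>2) = (t * \<beta> n)\<^sup>2 * (\<Sum>k\<le>n. (v n k)\<^sup>2)"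
        by (simp only: power_mult_distrib[of "t * \<beta> n"] sum_distrib_left[symmetric] lessThan_Suc_atMost)
      then show ?thesis by (simp only: normalised power_mult_distrib mult_1_right)
    qed
    have "(t\<^sup>2 * \<sigma>\<^sup>2 / 2 - \<epsilon>) * (\<beta> n)\<^sup>2 \<le> (1 - d)\<^sup>2 * \<sigma>\<^sup>2 / 2 * (t\<^sup>2 * (\<beta> n)\<^sup>2)"
    proof -
      have "(1 - 2 * d) * (t\<^sup>2 * \<sigma>\<^sup>2) \<le> (1 - d)\<^sup>2 * (t\<^sup>2 * \<sigma>\<^sup>2)"
        by (intro mult_right_mono) (auto simp: power2_diff)
      then have "t\<^sup>2 * \<sigma>\<^sup>2 / 2 - \<epsilon> \<le> (1 - d)\<^sup>2 * (t\<^sup>2 * \<sigma>\<^sup>2) / 2"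
        using \<open>d * (t\<^sup>2 * \<sigma>\<^sup>2) \<le> \<epsilon>\<close> by (simp add: left_diff_distrib)
      then have "(t\<^sup>2 * \<sigma>\<^sup>2 / 2 - \<epsilon>) * (\<beta> n)\<^sup>2 \<le> (1 - d)\<^sup>2 * (t\<^sup>2 * \<sigma>\<^sup>2) / 2 * (\<beta> n)\<^sup>2"
        by (rule mult_right_mono) simp
      then show ?thesis by (simp add: mult_ac)
    qed
    moreover have "(1 + d) * \<sigma>\<^sup>2 / 2 * (t\<^sup>2 * (\<beta> n)\<^sup>2) \<le> (t\<^sup>2 * \<sigma>\<^sup>2 / 2 + \<epsilon>) * (\<beta> n)\<^sup>2"
    proof -
      have "(1 + d) * (t\<^sup>2 * \<sigma>\<^sup>2) / 2 \<le> t\<^sup>2 * \<sigma>\<^sup>2 / 2 + \<epsilon>"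
        using \<open>d * (t\<^sup>2 * \<sigma>\<^sup>2) \<le> \<epsilon>\<close> \<open>\<epsilon> > 0\<close> by (simp add: distrib_right add_divide_distrib)
      then have "(1 + d) * (t\<^sup>2 * \<sigma>\<^sup>2) / 2 * (\<beta> n)\<^sup>2 \<le> (t\<^sup>2 * \<sigma>\<^sup>2 / 2 + \<epsilon>) * (\<beta> n)\<^sup>2"
        by (rule mult_right_mono) simp
      then show ?thesis by (simp add: mult_ac)
    qed
    ultimately show ?case
      using exponential_moment_weighted_noise[of "Suc n" "\<lambda>k. t * \<beta> n * v n k", OF vk less_imp_le[OF d(1)] d(2)]
      unfolding total scale by (meson exp_le_cancel_iff order_trans)
  qed
qed

text \<open>
  For \<open>E n\<close> to reach \<open>\<eta> * \<beta> n\<close>, the functional \<open>Q n\<close> must reach the order \<open>\<beta> n * sqrt n\<close>, at an exponential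
  cost of the same order. This exceeds \<open>C * sqrt n\<close> because \<open>\<beta> n\<close> tends to infinity, and every
  multiple of \<open>(\<beta> n)\<^sup>2\<close> because \<open>\<beta> n / sqrt n\<close> tends to 0.
\<close>

lemma (in conditional_noise) scaled_functional_negligible:
  fixes Q :: "nat \<Rightarrow> 'a \<Rightarrow> real"
  assumes speed: "filterlim \<beta> at_top sequentially"
    and slow: "(\<lambda>n. \<beta> n / sqrt (real (n + 1))) \<longlonglongrightarrow> 0"
    and pos: "\<kappa> > 0" "C \<ge> 0" "A > 0" "\<eta> > 0"
    and Qm [measurable]: "\<And>n. Q n \<in> borel_measurable M"
    and Em [measurable]: "\<And>n. E n \<in> borel_measurable M"
    and int: "\<And>n. integrable M (\<lambda>\<omega>. exp (\<kappa> * Q n \<omega>))"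
    and moment: "\<And>n. (\<integral>\<omega>. exp (\<kappa> * Q n \<omega>) \<partial>M) \<le> exp (C * sqrt (real (n + 1)))"
    and E: "\<And>n. AE \<omega> in M. \<bar>E n \<omega>\<bar> \<le> A / sqrt (real (n + 1)) * (1 + Q n \<omega>)"
  shows "eventually (\<lambda>n. prob {\<omega> \<in> space M. \<bar>E n \<omega>\<bar> \<ge> \<eta> * \<beta> n} \<le> exp (- L * (\<beta> n)\<^sup>2)) sequentially"
proof -
  have "eventually (\<lambda>n. 2 * A * (\<kappa> + C) / (\<kappa> * \<eta>) \<le> \<beta> n) sequentially"
    using speed unfolding filterlim_at_top by blast
  moreover have "eventually (\<lambda>n. 0 < \<beta> n) sequentially"
    using speed unfolding filterlim_at_top_dense by blast
  moreover have "eventually (\<lambda>n. \<beta> n / sqrt (real (n + 1)) < \<kappa> * \<eta> / (2 * A * (\<bar>L\<bar> + 1))) sequentially"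
    using pos by (intro order_tendstoD(2)[OF slow]) (auto intro!: divide_pos_pos mult_pos_pos)
  ultimately show ?thesis
  proof eventually_elim
    case (elim n)
    define m where "m = sqrt (real (n + 1))"
    have m: "m \<ge> 1" by (simp add: m_def)
    define a where "a = \<eta> * \<beta> n * m / A - 1"
    have "prob {\<omega> \<in> space M. \<bar>E n \<omega>\<bar> \<ge> \<eta> * \<beta> n} \<le> prob {\<omega> \<in> space M. Q n \<omega> \<ge> a}"
    proof (rule finite_measure_mono_AE)
      show "AE \<omega> in M. \<omega> \<in> {\<omega> \<in> space M. \<bar>E n \<omega>\<bar> \<ge> \<eta> * \<beta> n} \<longrightarrow> \<omega> \<in> {\<omega> \<in> space M. Q n \<omega> \<ge> a}"
        using E[of n]
      proof eventually_elim
        case (elim \<omega>)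
        have "a \<le> Q n \<omega>" if "\<eta> * \<beta> n \<le> \<bar>E n \<omega>\<bar>"
        proof -
          have "\<eta> * \<beta> n \<le> A / m * (1 + Q n \<omega>)" using elim that by (simp add: m_def)
          then have "\<eta> * \<beta> n * m / A \<le> 1 + Q n \<omega>" using m pos by (simp add: field_simps)
          then show ?thesis by (simp add: a_def)
        qed
        then show ?case by auto
      qed
    qed measurable
    also have "\<dots> \<le> exp (- \<kappa> * a) * (\<integral>\<omega>. exp (\<kappa> * Q n \<omega>) \<partial>M)"
      by (rule chernoff_bound) (use pos int in auto)
    also have "\<dots> \<le> exp (- \<kappa> * a) * exp (C * m)"
      using moment[of n] by (intro mult_left_mono) (auto simp: m_def)
    also have "\<dots> = exp (C * m - \<kappa> * a)" by (simp flip: exp_add)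
    also have "\<dots> \<le> exp (- L * (\<beta> n)\<^sup>2)"
      unfolding exp_le_cancel_iff
    proof -
      \<comment> \<open>Half of the exponent absorbs the moment bound, the other half dominates the speed.\<close>
      define w where "w = \<kappa> * \<eta> * \<beta> n * m / (2 * A)"
      have "\<kappa> + C \<le> \<kappa> * \<eta> * \<beta> n / (2 * A)" using elim(1) pos by (simp add: field_simps)
      then have "(\<kappa> + C) * m \<le> \<kappa> * \<eta> * \<beta> n / (2 * A) * m" using m by (intro mult_right_mono) auto
      then have "\<kappa> * m + C * m \<le> w" by (simp add: w_def distrib_right)
      moreover have "\<kappa> \<le> \<kappa> * m" using m pos mult_left_mono[OF m, of \<kappa>] by simp
      moreover have "(\<bar>L\<bar> + 1) * \<beta> n \<le> \<kappa> * \<eta> / (2 * A) * m"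
      proof -
        have "\<beta> n / m < \<kappa> * \<eta> / (2 * A * (\<bar>L\<bar> + 1))" using elim by (simp add: m_def)
        then have "\<beta> n < \<kappa> * \<eta> / (2 * A * (\<bar>L\<bar> + 1)) * m" using m by (simp add: pos_divide_less_eq)
        then have "(\<bar>L\<bar> + 1) * \<beta> n \<le> (\<bar>L\<bar> + 1) * (\<kappa> * \<eta> / (2 * A * (\<bar>L\<bar> + 1)) * m)"
          by (intro mult_left_mono) auto
        also have "\<dots> = \<kappa> * \<eta> / (2 * A) * m" by (simp add: add_nonneg_eq_0_iff)
        finally show ?thesis .
      qed
      then have "(\<bar>L\<bar> + 1) * \<beta> n * \<beta> n \<le> \<kappa> * \<eta> / (2 * A) * m * \<beta> n"
        using elim by (intro mult_right_mono) auto
      then have "(\<bar>L\<bar> + 1) * (\<beta> n)\<^sup>2 \<le> w" by (simp add: w_def power2_eq_square mult_ac)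
      moreover have "L * (\<beta> n)\<^sup>2 \<le> (\<bar>L\<bar> + 1) * (\<beta> n)\<^sup>2" by (intro mult_right_mono) auto
      moreover have "\<kappa> * a = 2 * w - \<kappa>" by (simp add: a_def w_def right_diff_distrib)
      ultimately show "C * m - \<kappa> * a \<le> - L * (\<beta> n)\<^sup>2" by linarith
    qed
    finally show ?case .
  qed
qed

theorem theorem2p3:
  fixes M :: "'a measure"
    and F :: "nat \<Rightarrow> 'a measure"
    and X U :: "nat \<Rightarrow> 'a \<Rightarrow> real"
    and g :: "real \<Rightarrow> real"
    and bs :: "nat \<Rightarrow> real"
    and b x0 xstar Ku \<sigma> Ka K1 K2 \<gamma> r :: real
  assumes "prob_space M"
    and "filtration (space M) F"
    and "\<And>n. subalgebra M (F n)"
    and "b > 0"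
    and "\<And>x. g differentiable (at x)"
    and "\<And>x. deriv g differentiable (at x)"
    and "\<And>n. n \<ge> 1 \<Longrightarrow> U n \<in> borel_measurable (F n)"
    and "\<And>n. X n \<in> borel_measurable (F n)"
    and "\<And>n. AE \<omega> in M. X (n + 1) \<omega> - X n \<omega> = b / real (n + 1) * (g (X n \<omega>) + U (n + 1) \<omega>)"
    and "AE \<omega> in M. X 0 \<omega> = x0"
    and "Ku > 0" and "\<sigma> > 0" and "Ka > 0" and "K1 > 0" and "K2 > 0"
    and "\<And>n. AE \<omega> in M. real_cond_exp M (F n) (U (n + 1)) \<omega> = 0"
    and "\<And>n. AE \<omega> in M. \<bar>U (n + 1) \<omega>\<bar> \<le> Ku"
    and "\<And>n. AE \<omega> in M. real_cond_exp M (F n) (\<lambda>\<omega>'. (U (n + 1) \<omega>')\<^sup>2) \<omega> = \<sigma>\<^sup>2"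
    and "\<And>x. \<bar>deriv (deriv g) x\<bar> \<le> Ka"
    and "stable_point g xstar"
    and "\<And>y. stable_point g y \<Longrightarrow> y = xstar"
    and "\<And>x. K1 * \<bar>x - xstar\<bar> \<le> \<bar>g x\<bar> \<and> \<bar>g x\<bar> \<le> K2 * \<bar>x - xstar\<bar>"
    and "b * deriv g xstar < - 1"
    and "\<And>n. n \<ge> 1 \<Longrightarrow> bs n > 0"
    and "filterlim bs at_top sequentially"
    and "\<gamma> > 0"
    and "bs \<in> O(\<lambda>n. real n powr (1 / (2 * (1 + \<gamma>))))"
    and "r > 0"
  shows "(\<lambda>n. 1 / (bs n)\<^sup>2 *
            ln (measure M {\<omega> \<in> space M.
                  h_norm b (b * deriv g xstar) n * \<bar>X (n + 1) \<omega> - xstar\<bar> > r * bs n}))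
         \<longlonglongrightarrow> - (r\<^sup>2 / (2 * \<sigma>\<^sup>2))"
proof -
  note pos = \<open>b > 0\<close> \<open>Ku > 0\<close> \<open>\<sigma> > 0\<close> \<open>Ka > 0\<close> \<open>K1 > 0\<close> \<open>K2 > 0\<close>
  interpret conditional_noise M F U Ku \<sigma>
    by (intro conditional_noise.intro conditional_noise_axioms.intro assms(1,2,3,7,11,12,16,17,18)) simp
  define c where "c = b * deriv g xstar"
  have c: "c < -1" using assms(23) by (simp add: c_def)
  define f where "f y = g (xstar + y)" for y
  define Y where "Y n \<omega> = X n \<omega> - xstar" for n \<omega>
  define h where "h n = h_norm b c n" for n
  define w where "w n k = noise_weight b c n k" for n k
  have growth: "\<bar>f y\<bar> \<le> K2 * \<bar>y\<bar>" for y
    using assms(22)[of "xstar + y"] by (simp add: f_def)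
  have revert: "y * f y \<le> - K1 * y\<^sup>2" for y
    unfolding f_def by (rule stable_point_restoring) (use assms(5,14,20,22) in auto)
  have lin: "\<bar>f y - c / b * y\<bar> \<le> Ka * y\<^sup>2" for y
  proof -
    have "\<bar>g (xstar + y) - g xstar - deriv g xstar * (xstar + y - xstar)\<bar> \<le> Ka * (xstar + y - xstar)\<^sup>2"
      by (rule quadratic_remainder_bound[where h'' = "deriv (deriv g)" and B = "max \<bar>xstar\<bar> \<bar>xstar + y\<bar>"])
        (use assms(5,6,19) in \<open>auto simp: DERIV_deriv_iff_real_differentiable\<close>)
    then show ?thesis using assms(20) pos by (simp add: f_def c_def stable_point_def)
  qed
  have YF: "Y n \<in> borel_measurable (F n)" for n
    using assms(8)[of n] unfolding Y_def by measurable
  have YM [measurable]: "Y n \<in> borel_measurable M" for n by (rule measurable_F_M[OF YF])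
  have paths: "AE \<omega> in M. Y 0 \<omega> = x0 - xstar \<and> (\<forall>n. \<bar>U (n + 1) \<omega>\<bar> \<le> Ku) \<and>
      (\<forall>n. Y (n + 1) \<omega> = Y n \<omega> + b / real (n + 1) * (f (Y n \<omega>) + U (n + 1) \<omega>))"
  proof -
    have "AE \<omega> in M. \<forall>n. \<bar>U (n + 1) \<omega>\<bar> \<le> Ku"
      "AE \<omega> in M. \<forall>n. X (n + 1) \<omega> - X n \<omega> = b / real (n + 1) * (g (X n \<omega>) + U (n + 1) \<omega>)"
      using assms(9,17) by (simp_all only: AE_all_countable) auto
    with assms(10) show ?thesis
    proof eventually_elim
      case (elim \<omega>)
      have "Y (n + 1) \<omega> = Y n \<omega> + b / real (n + 1) * (f (Y n \<omega>) + U (n + 1) \<omega>)" for n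
      proof -
        have f: "f (Y n \<omega>) = g (X n \<omega>)" by (simp add: f_def Y_def)
        show ?thesis unfolding f using elim(3)[rule_format, of n] by (simp add: Y_def)
      qed
      then show ?case using elim by (simp add: Y_def)
    qed
  qed
  obtain B where B: "B > 0" "\<And>y u n. y 0 = x0 - xstar \<Longrightarrow>
      (\<And>n. y (n + 1) = y n + b / real (n + 1) * (f (y n) + u (n + 1))) \<Longrightarrow>
      (\<And>n. \<bar>u (n + 1)\<bar> \<le> Ku) \<Longrightarrow> \<bar>y n\<bar> \<le> B"
    using mean_reverting_trajectories_bounded[OF \<open>b > 0\<close> \<open>K1 > 0\<close> \<open>Ku > 0\<close> growth revert, of "x0 - xstar"]
    by blast
  have YB: "AE \<omega> in M. \<bar>Y n \<omega>\<bar> \<le> B" for n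
    using paths
  proof eventually_elim
    case (elim \<omega>)
    show ?case
      by (rule B(2)[of "\<lambda>n. Y n \<omega>" "\<lambda>n. U n \<omega>"]) (use elim in blast)+
  qed
  obtain \<kappa> C where \<kappa>: "\<kappa> > 0" "C \<ge> 0"
    "\<And>n. integrable M (\<lambda>\<omega>. exp (\<kappa> * (\<Sum>k<n. (Y k \<omega>)\<^sup>2)))"
    "\<And>n. (\<integral>\<omega>. exp (\<kappa> * (\<Sum>k<n. (Y k \<omega>)\<^sup>2)) \<partial>M) \<le> exp (C * (\<Sum>k<n. 1 / real (k + 1)))"
  proof (rule exponential_moment_sum_squares[OF \<open>b > 0\<close> c \<open>K1 > 0\<close> \<open>Ka > 0\<close> B(1) \<open>K2 > 0\<close>
        growth lin revert YF _ YB])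
    show "AE \<omega> in M. Y (n + 1) \<omega> = Y n \<omega> + b / real (n + 1) * (f (Y n \<omega>) + U (n + 1) \<omega>)" for n
      using paths by eventually_elim blast
  qed (rule that)
  obtain W where W: "W > 0" "\<And>n. h n > 0"
    "\<And>n k. k \<le> n \<Longrightarrow> h n * \<bar>w n k\<bar> \<le> W / sqrt (real (n + 1))"
    "\<And>n. (\<Sum>k\<le>n. (h n * w n k)\<^sup>2) = 1"
    unfolding h_def w_def using normalised_noise_weights[OF \<open>b > 0\<close> less_imp_le[OF c]] by metis
  define S where "S n \<omega> = (\<Sum>k<Suc n. (h n * w n k) * U (Suc k) \<omega>)" for n \<omega>
  define E where "E n \<omega> = h n * Y (Suc n) \<omega> - S n \<omega>" for n \<omega>
  have slow: "(\<lambda>n. bs n / sqrt (real (n + 1))) \<longlonglongrightarrow> 0"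
    by (rule speed_below_sqrt) (use assms(26,27) in auto)
  have small: "\<bar>h n * w n k\<bar> \<le> W / sqrt (real (n + 1))" if "k \<le> n" for n k
    using W(3)[OF that] W(2)[of n] by (simp add: abs_mult)
  interpret gaussian_log_moments M S bs "\<sigma>\<^sup>2"
    unfolding S_def by (rule gaussian_log_moments_weighted_noise[OF assms(25) slow W(1) small W(4)])
  have EM [measurable]: "E n \<in> borel_measurable M" for n unfolding E_def by measurable
  define A where "A = W * (Ka + \<bar>1 + c\<bar> / b * \<bar>x0 - xstar\<bar>)"
  have "A > 0" using W pos by (auto simp: A_def intro!: mult_pos_pos add_pos_nonneg)
  \<comment> \<open>What separates the normalised error from the weighted noise is the contribution of the initial value, a multiple of the weight at \<open>k = 0\<close>, and that of the linearisation errors, which are quadratic in \<open>Y\<close>.\<close>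
  have E_bound: "AE \<omega> in M. \<bar>E n \<omega>\<bar> \<le> A / sqrt (real (n + 1)) * (1 + (\<Sum>k<Suc n. (Y k \<omega>)\<^sup>2))" for n
    using paths
  proof eventually_elim
    case (elim \<omega>)
    define R where "R k = f (Y k \<omega>) - c / b * Y k \<omega>" for k
    define m where "m = sqrt (real (n + 1))"
    have m: "m > 0" by (simp add: m_def)
    have "Y (Suc n) \<omega> = beta_prod 0 n c * Y 0 \<omega> + (\<Sum>k\<le>n. w n k * (R k + U (Suc k) \<omega>))"
      unfolding w_def
    proof (rule linear_recursion_solution)
      fix k
      have "Y (Suc k) \<omega> = Y k \<omega> + b / real (k + 1) * (f (Y k \<omega>) + U (Suc k) \<omega>)"
        using elim by simp
      also have "\<dots> = (1 + c / real (k + 1)) * Y k \<omega> + b / real (k + 1) * (R k + U (Suc k) \<omega>)"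
      proof -
        have "b / real (k + 1) * (c / b * Y k \<omega>) = c / real (k + 1) * Y k \<omega>" using pos by simp
        then show ?thesis unfolding R_def distrib_left distrib_right right_diff_distrib by linarith
      qed
      finally show "Y (Suc k) \<omega> = (1 + c / real (k + 1)) * Y k \<omega> + b / real (k + 1) * (R k + U (Suc k) \<omega>)" .
    qed
    also have "beta_prod 0 n c = (1 + c) / b * w n 0"
      using pos by (simp add: beta_prod_def w_def noise_weight_def prod.atLeast_Suc_atMost)
    finally have Y_Suc: "Y (Suc n) \<omega> = (1 + c) / b * w n 0 * Y 0 \<omega> + (\<Sum>k\<le>n. w n k * (R k + U (Suc k) \<omega>))" .
    have "h n * (a * w n 0 * y + (\<Sum>k\<le>n. w n k * (R k + U (Suc k) \<omega>)))
        = a * y * (h n * w n 0) + (\<Sum>k<Suc n. h n * w n k * R k) + S n \<omega>" for a y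
      unfolding S_def lessThan_Suc_atMost
      by (simp add: distrib_left sum.distrib sum_distrib_left mult_ac)
    from this[of "(1 + c) / b" "Y 0 \<omega>"]
    have "E n \<omega> = (1 + c) / b * (x0 - xstar) * (h n * w n 0) + (\<Sum>k<Suc n. h n * w n k * R k)"
      using elim unfolding E_def Y_Suc by simp
    also have "\<bar>\<dots>\<bar> \<le> \<bar>(1 + c) / b * (x0 - xstar) * (h n * w n 0)\<bar> + (\<Sum>k<Suc n. \<bar>h n * w n k * R k\<bar>)"
      by (intro order_trans[OF abs_triangle_ineq] add_left_mono sum_abs)
    also have "\<dots> \<le> \<bar>1 + c\<bar> / b * \<bar>x0 - xstar\<bar> * (W / m) + (\<Sum>k<Suc n. W / m * (Ka * (Y k \<omega>)\<^sup>2))"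
    proof (intro add_mono sum_mono)
      have "h n * \<bar>w n 0\<bar> \<le> W / m" using W(3)[of 0 n] by (simp add: m_def)
      then have "\<bar>1 + c\<bar> / b * \<bar>x0 - xstar\<bar> * (h n * \<bar>w n 0\<bar>) \<le> \<bar>1 + c\<bar> / b * \<bar>x0 - xstar\<bar> * (W / m)"
        using pos by (intro mult_left_mono) auto
      then show "\<bar>(1 + c) / b * (x0 - xstar) * (h n * w n 0)\<bar> \<le> \<bar>1 + c\<bar> / b * \<bar>x0 - xstar\<bar> * (W / m)"
        using pos W(2)[of n] by (simp add: abs_mult)
    next
      fix k assume "k \<in> {..<Suc n}"
      then have "h n * \<bar>w n k\<bar> \<le> W / m" using W(3)[of k n] by (simp add: m_def)
      then have "h n * \<bar>w n k\<bar> * \<bar>R k\<bar> \<le> W / m * (Ka * (Y k \<omega>)\<^sup>2)"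
        using W(1) m lin by (intro mult_mono) (auto simp: R_def)
      then show "\<bar>h n * w n k * R k\<bar> \<le> W / m * (Ka * (Y k \<omega>)\<^sup>2)"
        using W(2)[of n] by (simp add: abs_mult)
    qed
    also have "\<dots> = W / m * (\<bar>1 + c\<bar> / b * \<bar>x0 - xstar\<bar> + Ka * (\<Sum>k<Suc n. (Y k \<omega>)\<^sup>2))"
      unfolding sum_distrib_left[symmetric] by (simp only: distrib_left mult_ac)
    also have "\<dots> \<le> W / m * ((Ka + \<bar>1 + c\<bar> / b * \<bar>x0 - xstar\<bar>) * (1 + (\<Sum>k<Suc n. (Y k \<omega>)\<^sup>2)))"
    proof (intro mult_left_mono)
      have "0 \<le> (\<Sum>k<Suc n. (Y k \<omega>)\<^sup>2)" by (intro sum_nonneg) auto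
      then have "0 \<le> \<bar>1 + c\<bar> / b * \<bar>x0 - xstar\<bar> * (\<Sum>k<Suc n. (Y k \<omega>)\<^sup>2)" using pos by simp
      then show "\<bar>1 + c\<bar> / b * \<bar>x0 - xstar\<bar> + Ka * (\<Sum>k<Suc n. (Y k \<omega>)\<^sup>2)
          \<le> (Ka + \<bar>1 + c\<bar> / b * \<bar>x0 - xstar\<bar>) * (1 + (\<Sum>k<Suc n. (Y k \<omega>)\<^sup>2))"
        using pos by (simp only: distrib_left distrib_right mult_1_right)
    qed (use W(1) m in auto)
    finally show ?case by (simp add: A_def m_def)
  qed
  have negligible: "eventually (\<lambda>n. prob {\<omega> \<in> space M. \<bar>E n \<omega>\<bar> \<ge> \<eta> * bs n} \<le> exp (- L * (bs n)\<^sup>2)) sequentially"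
    if "\<eta> > 0" for \<eta> L
  proof (rule scaled_functional_negligible[OF assms(25) slow \<kappa>(1) _ \<open>A > 0\<close> that _ EM \<kappa>(3) _ E_bound])
    show "0 \<le> 2 * C" using \<kappa>(2) by simp
    show "(\<lambda>\<omega>. \<Sum>k<Suc n. (Y k \<omega>)\<^sup>2) \<in> borel_measurable M" for n by measurable
    show "(\<integral>\<omega>. exp (\<kappa> * (\<Sum>k<Suc n. (Y k \<omega>)\<^sup>2)) \<partial>M) \<le> exp (2 * C * sqrt (real (n + 1)))" for n
    proof -
      have "C * (\<Sum>k<Suc n. 1 / real (k + 1)) \<le> C * (2 * sqrt (real (Suc n)))"
        by (rule mult_left_mono[OF sum_inverse_le_sqrt \<kappa>(2)])
      then have "exp (C * (\<Sum>k<Suc n. 1 / real (k + 1))) \<le> exp (2 * C * sqrt (real (n + 1)))"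
        by (simp add: mult_ac)
      with \<kappa>(4)[of "Suc n"] show ?thesis by (rule order_trans)
    qed
  qed
  have "(\<lambda>n. 1 / (bs n)\<^sup>2 * ln (prob {\<omega> \<in> space M. \<bar>h n * Y (Suc n) \<omega>\<bar> > r * bs n}))
      \<longlonglongrightarrow> - (r\<^sup>2 / (2 * \<sigma>\<^sup>2))"
    by (rule perturbed_two_sided_tail[OF _ EM _ negligible \<open>r > 0\<close>]) (auto simp: E_def)
  moreover have "\<bar>h n * Y (Suc n) \<omega>\<bar> = h_norm b (b * deriv g xstar) n * \<bar>X (n + 1) \<omega> - xstar\<bar>" for n \<omega>
    using W(2)[of n] by (simp add: abs_mult h_def Y_def c_def)
  ultimately show ?thesis by simp
qed

end
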